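(* Let $\mathbb{K}$ be a field, $\lambda\in\mathbb{K}$, $\ell\ge1$, let $k_1,\dots,k_\ell$ and $r_1>\cdots>r_\ell$ be positive integers, and let $J_\lambda=\bigoplus_{i=1}^\ell k_iJ_{\lambda,r_i}$. Let $I_\lambda\subseteq R$ be the ideal generated by the $2\times2$ minors of $(J_\lambda\boldsymbol{x}\mid\boldsymbol{x})$. For each $j\in\{1,\dots,\ell\}$ let $G_j'=\{x(\boldsymbol{i}) : \boldsymbol{i}\in\Lambda_{j,1}\cup\Lambda_{j,2}\}$ and let $\mathfrak{q}_{\lambda,j}=I_\lambda+\langle G'_j\rangle$. Then $G\cup G_j'$ is a Gröbner basis of $\mathfrak{q}_{\lambda,j}$ with respect to the graded reverse lexicographic order, where $G$, $\Lambda_{j,1}$, $\Lambda_{j,2}$ and the ordering of the variables are as in the context.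
   Context: $J_{\lambda,r}$ denotes the $r\times r$ Jordan block with $\lambda$ on the diagonal and $1$ on the superdiagonal; $kJ_{\lambda,r}$ is the direct sum (block diagonal matrix) of $k$ copies of $J_{\lambda,r}$. The rows of $J_\lambda$ are indexed by $\Lambda=\{(i_1,i_2,i_3): 1\le i_1\le\ell,\ 1\le i_2\le k_{i_1},\ 1\le i_3\le r_{i_1}\}$ in lexicographically increasing order: $(i_1,i_2,i_3)$ is the $i_3$-th row of the $i_2$-th copy of $J_{\lambda,r_{i_1}}$. $R=\mathbb{K}[x(\boldsymbol{i}):\boldsymbol{i}\in\Lambda]$, and $\boldsymbol{x}$ is the column vector of the variables in this order. $(J_\lambda\boldsymbol{x}\mid\boldsymbol{x})$ is the two-column matrix with columns $J_\lambda\boldsymbol{x}$ and $\boldsymbol{x}$. Order $\Lambda$ totally by: $(i_1,i_2,i_3)>(j_1,j_2,j_3)$ iff $i_1<j_1$, or $i_1=j_1$ and $i_2<j_2$, or $i_1=j_1$, $i_2=j_2$ and $i_3<j_3$; and order the variables by $x(\boldsymbol{i})>x(\boldsymbol{j})$ iff $\boldsymbol{i}>\boldsymbol{j}$. The graded reverse lexicographic order is taken with respect to this ordering of the variables. Definition of $G$. For pairs $\boldsymbol{i}=(i_1,i_2,i_3)>\boldsymbol{j}=(j_1,j_2,j_3)$ in $\Lambda$ with $i_3<r_{i_1}$, put $\boldsymbol{i}^+=(i_1,i_2,i_3+1)$. Let $\varGamma_1$ be the set of such pairs with $j_3<r_{j_1}$ and $i_3+j_3\ge r_{j_1}+1$;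 $\varGamma_2$ the set of such pairs with $j_3<r_{j_1}$ and $i_3+j_3\le r_{j_1}$; $\varGamma_3$ the set of such pairs with $j_3=r_{j_1}$. For $(\boldsymbol{i},\boldsymbol{j})\in\varGamma_2$ put $g(\boldsymbol{i},\boldsymbol{j})=x(\boldsymbol{i}^+)x(\boldsymbol{j})-x(i_1,i_2,1)\,x(j_1,j_2,i_3+j_3)$. If $r_1>1$, then $G=\{x(\boldsymbol{i}^+)x(\boldsymbol{j}) : (\boldsymbol{i},\boldsymbol{j})\in\varGamma_1\cup\varGamma_3\}\cup\{g(\boldsymbol{i},\boldsymbol{j}) : (\boldsymbol{i},\boldsymbol{j})\in\varGamma_2\}$; if $r_1=1$, then $G=\{0\}$. For $j\in\{1,\dots,\ell\}$: $\Lambda_{j,1}=\{(i_1,i_2,i_3)\in\Lambda: i_1\le j,\ r_j+1\le i_3\le r_{i_1}\}$ and $\Lambda_{j,2}=\{(i_1,i_2,i_3)\in\Lambda: i_1>j\}$. The element $0$ and the empty set are allowed in/as generating sets; $\{0\}$ counts as a Gröbner basis of the zero ideal. *)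

theory Defs
  imports
    "HOL-Library.Poly_Mapping"
    "HOL-Algebra.Ideal"
    "Jordan_Normal_Form.Jordan_Normal_Form"
    "Jordan_Normal_Form.DL_Submatrix"
begin

section \<open>Polynomial rings in a prescribed set of variables\<close>

type_synonym 'v monom = "'v \<Rightarrow>\<^sub>0 nat"
type_synonym ('v, 'a) mpoly = "'v monom \<Rightarrow>\<^sub>0 'a"

definition const_poly :: "'a::zero \<Rightarrow> ('v, 'a) mpoly" where
  "const_poly c = Poly_Mapping.single 0 c"

definition monom_poly :: "'v monom \<Rightarrow> ('v, 'a::zero_neq_one) mpoly" where
  "monom_poly m = Poly_Mapping.single m 1"

definition var :: "'v \<Rightarrow> ('v, 'a::zero_neq_one) mpoly" where
  "var v = monom_poly (Poly_Mapping.single v 1)"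

text \<open>The type \<open>('v, 'a) mpoly\<close> contains polynomials in all variables of type \<open>'v\<close>;
  the ring \<open>poly_ring V\<close> is its subring of polynomials in the variables from \<open>V\<close> only.
  Ideals are taken in this ring.\<close>

definition poly_ring :: "'v set \<Rightarrow> ('v, 'a::comm_ring_1) mpoly ring" where
  "poly_ring V =
    \<lparr>carrier = {p. \<forall>m \<in> Poly_Mapping.keys p. Poly_Mapping.keys m \<subseteq> V},
     monoid.mult = (*), one = 1, zero = 0, add = (+)\<rparr>"

lemma poly_ring_simps:
  "p \<in> carrier (poly_ring V) \<longleftrightarrow> (\<forall>m \<in> Poly_Mapping.keys p. Poly_Mapping.keys m \<subseteq> V)"
  "p \<otimes>\<^bsub>poly_ring V\<^esub> q = p * q"
  "p \<oplus>\<^bsub>poly_ring V\<^esub> q = p + q"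
  "\<one>\<^bsub>poly_ring V\<^esub> = 1"
  "\<zero>\<^bsub>poly_ring V\<^esub> = 0"
  by (simp_all add: poly_ring_def)

lemma poly_ring_cring: "cring (poly_ring V)"
proof -
  note ops = poly_ring_simps(2-5)
  have zero: "0 \<in> carrier (poly_ring V)" and one: "1 \<in> carrier (poly_ring V)"
    by (simp_all add: poly_ring_simps)
  have add: "p + q \<in> carrier (poly_ring V)"
    if "p \<in> carrier (poly_ring V)" "q \<in> carrier (poly_ring V)" for p q
    using that Poly_Mapping.keys_add[of p q] unfolding poly_ring_simps by blast
  have mult: "p * q \<in> carrier (poly_ring V)"
    if pq: "p \<in> carrier (poly_ring V)" "q \<in> carrier (poly_ring V)" for p q
  proof -
    have "Poly_Mapping.keys m \<subseteq> V" if "m \<in> Poly_Mapping.keys (p * q)" for m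
    proof -
      obtain a b where "a \<in> Poly_Mapping.keys p" "b \<in> Poly_Mapping.keys q" and m: "m = a + b"
        using \<open>m \<in> Poly_Mapping.keys (p * q)\<close> keys_mult[of p q] by blast
      then have "Poly_Mapping.keys a \<subseteq> V" "Poly_Mapping.keys b \<subseteq> V"
        using pq unfolding poly_ring_simps by blast+
      then show ?thesis
        using Poly_Mapping.keys_add[of a b] unfolding m by blast
    qed
    then show ?thesis by (simp add: poly_ring_simps)
  qed
  have neg: "\<exists>q \<in> carrier (poly_ring V). p + q = 0" if "p \<in> carrier (poly_ring V)" for p
    using that by (intro bexI[of _ "- p"]) (simp_all add: poly_ring_simps)
  show ?thesis
  proof (rule cringI)
    show "abelian_group (poly_ring V)"
      by (rule abelian_groupI)
        (simp_all only: ops zero add neg add.assoc add.commute add.left_commute add_0_left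
            add_0_right)
    show "comm_monoid (poly_ring V)"
      by (rule comm_monoidI)
        (simp_all only: ops one mult mult.assoc mult.commute mult.left_commute mult_1_left
            mult_1_right)
  qed (simp only: ops distrib_right)
qed

section \<open>Monomial orders and Groebner bases\<close>

definition total_degree :: "'v monom \<Rightarrow> nat" where
  "total_degree m = (\<Sum>v \<in> Poly_Mapping.keys m. Poly_Mapping.lookup m v)"

text \<open>Here \<open>vgt v w\<close> means that the variable \<open>v\<close> is bigger than the variable \<open>w\<close>. In equal
  degree, the bigger monomial is the one with the smaller exponent at the smallest variable
  at which the two monomials differ.\<close>

definition grevlex_greater ::
  "('v \<Rightarrow> 'v \<Rightarrow> bool) \<Rightarrow> 'v monom \<Rightarrow> 'v monom \<Rightarrow> bool" where
  "grevlex_greater vgt s t \<longleftrightarrow>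
     total_degree s > total_degree t \<or>
     total_degree s = total_degree t \<and>
     (\<exists>v. Poly_Mapping.lookup s v < Poly_Mapping.lookup t v \<and>
          (\<forall>w. vgt v w \<longrightarrow> Poly_Mapping.lookup s w = Poly_Mapping.lookup t w))"

definition leading_monom ::
  "('v monom \<Rightarrow> 'v monom \<Rightarrow> bool) \<Rightarrow> ('v, 'a::zero) mpoly \<Rightarrow> 'v monom" where
  "leading_monom gt p =
     (THE m. m \<in> Poly_Mapping.keys p \<and> (\<forall>m' \<in> Poly_Mapping.keys p. m' \<noteq> m \<longrightarrow> gt m m'))"

definition initial_ideal ::
  "'v set \<Rightarrow> ('v monom \<Rightarrow> 'v monom \<Rightarrow> bool) \<Rightarrow> ('v, 'a::comm_ring_1) mpoly set
     \<Rightarrow> ('v, 'a) mpoly set" where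
  "initial_ideal V gt F =
     Idl\<^bsub>poly_ring V\<^esub> {monom_poly (leading_monom gt f) | f. f \<in> F \<and> f \<noteq> 0}"

text \<open>The zero polynomial may belong to \<open>G\<close>; it contributes nothing to the initial ideal.\<close>

definition groebner_basis ::
  "'v set \<Rightarrow> ('v monom \<Rightarrow> 'v monom \<Rightarrow> bool) \<Rightarrow> ('v, 'a::field) mpoly set
     \<Rightarrow> ('v, 'a) mpoly set \<Rightarrow> bool" where
  "groebner_basis V gt G I \<longleftrightarrow>
     ideal I (poly_ring V) \<and> finite G \<and> G \<subseteq> I \<and>
     initial_ideal V gt G = initial_ideal V gt I"

section \<open>The matrix and its ideal of minors\<close>

definition minors :: "nat \<Rightarrow> 'a::comm_ring_1 mat \<Rightarrow> 'a set" where
  "minors t A =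
     {det (submatrix A P Q) | P Q.
        P \<subseteq> {0..<dim_row A} \<and> card P = t \<and> Q \<subseteq> {0..<dim_col A} \<and> card Q = t}"

type_synonym idx = "nat \<times> nat \<times> nat"

definition Lam :: "nat \<Rightarrow> (nat \<Rightarrow> nat) \<Rightarrow> (nat \<Rightarrow> nat) \<Rightarrow> idx set" where
  "Lam l k r =
     {(i1, i2, i3). 1 \<le> i1 \<and> i1 \<le> l \<and> 1 \<le> i2 \<and> i2 \<le> k i1 \<and> 1 \<le> i3 \<and> i3 \<le> r i1}"

text \<open>\<open>idx_greater i j\<close> is \<open>i > j\<close>: lexicographically earlier indices, that is, variables
  higher up in the column vector, are bigger.\<close>

fun idx_greater :: "idx \<Rightarrow> idx \<Rightarrow> bool" where
  "idx_greater (i1, i2, i3) (j1, j2, j3) \<longleftrightarrow>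
     i1 < j1 \<or> i1 = j1 \<and> i2 < j2 \<or> i1 = j1 \<and> i2 = j2 \<and> i3 < j3"

definition Lam_list :: "nat \<Rightarrow> (nat \<Rightarrow> nat) \<Rightarrow> (nat \<Rightarrow> nat) \<Rightarrow> idx list" where
  "Lam_list l k r =
     [(i1, i2, i3). i1 \<leftarrow> [1..<Suc l], i2 \<leftarrow> [1..<Suc (k i1)], i3 \<leftarrow> [1..<Suc (r i1)]]"

lemma set_Lam_list: "set (Lam_list l k r) = Lam l k r"
  by (auto simp: Lam_list_def Lam_def image_iff simp del: upt_Suc)

lemma sorted_wrt_concat_map:
  assumes "sorted_wrt R xs"
    and "\<And>x. x \<in> set xs \<Longrightarrow> sorted_wrt S (f x)"
    and "\<And>x y a b. R x y \<Longrightarrow> a \<in> set (f x) \<Longrightarrow> b \<in> set (f y) \<Longrightarrow> S a b"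
  shows "sorted_wrt S (concat (map f xs))"
  using assms(1,2)
proof (induction xs)
  case (Cons x xs)
  then have "sorted_wrt S (concat (map f xs))" "sorted_wrt S (f x)" by simp_all
  moreover have "S a b" if "a \<in> set (f x)" "b \<in> set (concat (map f xs))" for a b
    using that Cons.prems(1) assms(3) by auto
  ultimately show ?case by (simp add: sorted_wrt_append)
qed simp

lemma sorted_Lam_list: "sorted_wrt idx_greater (Lam_list l k r)"
  unfolding Lam_list_def
  by (intro sorted_wrt_concat_map[where R = "(<)"])
    (auto simp: sorted_wrt_map strict_sorted_iff simp del: upt_Suc)

definition var_vec ::
  "nat \<Rightarrow> (nat \<Rightarrow> nat) \<Rightarrow> (nat \<Rightarrow> nat) \<Rightarrow> (idx, 'a::comm_ring_1) mpoly vec" where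
  "var_vec l k r = vec_of_list (map var (Lam_list l k r))"

definition J_mat :: "nat \<Rightarrow> (nat \<Rightarrow> nat) \<Rightarrow> (nat \<Rightarrow> nat) \<Rightarrow> 'a::zero_neq_one \<Rightarrow> 'a mat" where
  "J_mat l k r c = jordan_matrix (concat (map (\<lambda>i. replicate (k i) (r i, c)) [1..<Suc l]))"

definition Jx_x_mat ::
  "nat \<Rightarrow> (nat \<Rightarrow> nat) \<Rightarrow> (nat \<Rightarrow> nat) \<Rightarrow> 'a::comm_ring_1 \<Rightarrow> (idx, 'a) mpoly mat" where
  "Jx_x_mat l k r c =
     mat_of_cols (length (Lam_list l k r))
       [map_mat const_poly (J_mat l k r c) *\<^sub>v var_vec l k r, var_vec l k r]"

definition I_ideal ::
  "nat \<Rightarrow> (nat \<Rightarrow> nat) \<Rightarrow> (nat \<Rightarrow> nat) \<Rightarrow> 'a::comm_ring_1 \<Rightarrow> (idx, 'a) mpoly set" where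
  "I_ideal l k r c = Idl\<^bsub>poly_ring (Lam l k r)\<^esub> (minors 2 (Jx_x_mat l k r c))"

section \<open>The sets \<open>G\<close> and \<open>G'\<^sub>j\<close>\<close>

definition Gam1 :: "nat \<Rightarrow> (nat \<Rightarrow> nat) \<Rightarrow> (nat \<Rightarrow> nat) \<Rightarrow> (idx \<times> idx) set" where
  "Gam1 l k r =
     {((i1, i2, i3), (j1, j2, j3)).
        (i1, i2, i3) \<in> Lam l k r \<and> (j1, j2, j3) \<in> Lam l k r \<and>
        idx_greater (i1, i2, i3) (j1, j2, j3) \<and> i3 < r i1 \<and>
        j3 < r j1 \<and> i3 + j3 \<ge> r j1 + 1}"

definition Gam2 :: "nat \<Rightarrow> (nat \<Rightarrow> nat) \<Rightarrow> (nat \<Rightarrow> nat) \<Rightarrow> (idx \<times> idx) set" where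
  "Gam2 l k r =
     {((i1, i2, i3), (j1, j2, j3)).
        (i1, i2, i3) \<in> Lam l k r \<and> (j1, j2, j3) \<in> Lam l k r \<and>
        idx_greater (i1, i2, i3) (j1, j2, j3) \<and> i3 < r i1 \<and>
        j3 < r j1 \<and> i3 + j3 \<le> r j1}"

definition Gam3 :: "nat \<Rightarrow> (nat \<Rightarrow> nat) \<Rightarrow> (nat \<Rightarrow> nat) \<Rightarrow> (idx \<times> idx) set" where
  "Gam3 l k r =
     {((i1, i2, i3), (j1, j2, j3)).
        (i1, i2, i3) \<in> Lam l k r \<and> (j1, j2, j3) \<in> Lam l k r \<and>
        idx_greater (i1, i2, i3) (j1, j2, j3) \<and> i3 < r i1 \<and>
        j3 = r j1}"

fun idx_succ :: "idx \<Rightarrow> idx" where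
  "idx_succ (i1, i2, i3) = (i1, i2, i3 + 1)"

fun g_poly :: "idx \<Rightarrow> idx \<Rightarrow> (idx, 'a::comm_ring_1) mpoly" where
  "g_poly (i1, i2, i3) (j1, j2, j3) =
     var (idx_succ (i1, i2, i3)) * var (j1, j2, j3) - var (i1, i2, 1) * var (j1, j2, i3 + j3)"

definition G_set ::
  "nat \<Rightarrow> (nat \<Rightarrow> nat) \<Rightarrow> (nat \<Rightarrow> nat) \<Rightarrow> (idx, 'a::comm_ring_1) mpoly set" where
  "G_set l k r =
     (if r 1 > 1
      then {var (idx_succ i) * var j | i j. (i, j) \<in> Gam1 l k r \<union> Gam3 l k r} \<union>
           {g_poly i j | i j. (i, j) \<in> Gam2 l k r}
      else {0})"

definition Lam_j1 :: "nat \<Rightarrow> (nat \<Rightarrow> nat) \<Rightarrow> (nat \<Rightarrow> nat) \<Rightarrow> nat \<Rightarrow> idx set" where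
  "Lam_j1 l k r j =
     {(i1, i2, i3) \<in> Lam l k r. i1 \<le> j \<and> r j + 1 \<le> i3 \<and> i3 \<le> r i1}"

definition Lam_j2 :: "nat \<Rightarrow> (nat \<Rightarrow> nat) \<Rightarrow> (nat \<Rightarrow> nat) \<Rightarrow> nat \<Rightarrow> idx set" where
  "Lam_j2 l k r j = {(i1, i2, i3) \<in> Lam l k r. i1 > j}"

definition G'_set ::
  "nat \<Rightarrow> (nat \<Rightarrow> nat) \<Rightarrow> (nat \<Rightarrow> nat) \<Rightarrow> nat \<Rightarrow> (idx, 'a::comm_ring_1) mpoly set" where
  "G'_set l k r j = var ` (Lam_j1 l k r j \<union> Lam_j2 l k r j)"

definition q_ideal ::
  "nat \<Rightarrow> (nat \<Rightarrow> nat) \<Rightarrow> (nat \<Rightarrow> nat) \<Rightarrow> 'a::comm_ring_1 \<Rightarrow> nat \<Rightarrow> (idx, 'a) mpoly set" where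
  "q_ideal l k r c j =
     I_ideal l k r c <+>\<^bsub>poly_ring (Lam l k r)\<^esub> Idl\<^bsub>poly_ring (Lam l k r)\<^esub> (G'_set l k r j)"

end

theory Submission
  imports Defs
begin

text \<open>Write \<open>q\<close> for the ideal \<open>q_ideal l k r lam j\<close>. Modulo the variables in \<open>G'_set l k r j\<close> all Jordan blocks have
  size \<open>r j\<close>, and \<open>x(a,b,c) \<mapsto> u\<^bsub>a,b\<^esub> s\<^bsup>c-1\<^esup>\<close>, with \<open>s\<^bsup>r j\<^esup> = 0\<close>, maps \<open>q\<close> to zero. This map sends every
  monomial to a monomial or to zero. A monomial divisible by no leading monomial of
  \<open>G \<union> G'\<close> is a product of variables \<open>x(a,b,1)\<close> times at most one further variable, lying in the
  last block that occurs; hence its image is nonzero and it is the smallest monomial of its fibre.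
  If such a monomial were the leading monomial of some \<open>p \<in> q\<close>, no other monomial of \<open>p\<close>
  could have the same image, and the image of \<open>p\<close> would be nonzero. So no reduction of
  S-polynomials is needed.\<close>

section \<open>The minors of (Jx | x)\<close>

lemma vec_of_list_append: "vec_of_list (xs @ ys) = vec_of_list xs @\<^sub>v vec_of_list ys"
  by (rule eq_vecI) (simp_all add: vec_of_list_index nth_append)

lemma jordan_block_mult_vec:
  fixes a :: "'a::comm_ring_1"
  shows "jordan_block (length xs) a *\<^sub>v vec_of_list xs =
    vec (length xs) (\<lambda>i. a * xs ! i + (if Suc i < length xs then xs ! Suc i else 0))"
proof (rule eq_vecI)
  fix i assume "i < dim_vec (vec (length xs) (\<lambda>i. a * xs ! i + (if Suc i < length xs then xs ! Suc i else 0)))"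
  then have i: "i < length xs" by simp
  have "(jordan_block (length xs) a *\<^sub>v vec_of_list xs) $ i =
      (\<Sum>j = 0..<length xs. (if i = j then a else if Suc i = j then 1 else 0) * xs ! j)"
    using i by (auto simp: scalar_prod_def vec_of_list_index intro!: sum.cong)
  also have "\<dots> = (\<Sum>j = 0..<length xs. (if i = j then a * xs ! j else 0) +
      (if Suc i = j then xs ! j else 0))"
    by (intro sum.cong) auto
  also have "\<dots> = a * xs ! i + (if Suc i < length xs then xs ! Suc i else 0)"
    using i by (simp add: sum.distrib)
  finally show "(jordan_block (length xs) a *\<^sub>v vec_of_list xs) $ i =
      vec (length xs) (\<lambda>i. a * xs ! i + (if Suc i < length xs then xs ! Suc i else 0)) $ i"
    using i by simp
qed simp

text \<open>Off the diagonal a Jordan matrix has only the entries 0 and 1, so fixing these two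
  values suffices. Used with \<open>const_poly\<close> to carry \<open>J_mat\<close> over to the
  polynomial ring.\<close>

lemma map_mat_jordan_matrix:
  assumes "f 0 = 0" "f 1 = 1"
  shows "map_mat f (jordan_matrix nas) = jordan_matrix (map (apsnd f) nas)"
proof (induction nas)
  case Nil
  show ?case by (auto simp: jordan_matrix_def)
next
  case (Cons na nas)
  obtain n a where na: "na = (n, a)" by force
  have block: "map_mat f (jordan_block n a) = jordan_block n (f a)"
    by (rule eq_matI) (auto simp: assms)
  have step: "jordan_matrix ((n, b) # bs) = four_block_mat (jordan_block n b)
      (0\<^sub>m n (sum_list (map fst bs))) (0\<^sub>m (sum_list (map fst bs)) n) (jordan_matrix bs)"
    for b :: "'x::{zero,one}" and bs
    using jordan_matrix_dim[of bs] by (simp add: jordan_matrix_def Let_def)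
  let ?m = "sum_list (map fst nas)"
  have zero: "map_mat f (0\<^sub>m p q) = 0\<^sub>m p q" for p q
    by (rule eq_matI) (auto simp: assms)
  have "map_mat f (jordan_matrix (na # nas)) =
      four_block_mat (map_mat f (jordan_block n a)) (map_mat f (0\<^sub>m n ?m))
        (map_mat f (0\<^sub>m ?m n)) (map_mat f (jordan_matrix nas))"
    unfolding na step by (rule map_four_block_mat) auto
  then show ?case
    unfolding zero block Cons.IH by (simp add: na step comp_def)
qed

text \<open>Induction over the diagonal blocks. Rows carry labels, and \<open>s\<close> is the
  superdiagonal contribution of a label: the value at the next label of its block, or 0 at the end
  of the block. This turns the product into a single map over the concatenated list.\<close>

lemma jordan_matrix_mult_vec:
  fixes c :: "'a::comm_ring_1" and f s :: "'b \<Rightarrow> 'a"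
  assumes "\<And>xs p. xs \<in> set xss \<Longrightarrow> p < length xs \<Longrightarrow>
    s (xs ! p) = (if Suc p < length xs then f (xs ! Suc p) else 0)"
  shows "jordan_matrix (map (\<lambda>xs. (length xs, c)) xss) *\<^sub>v vec_of_list (map f (concat xss)) =
    vec_of_list (map (\<lambda>v. c * f v + s v) (concat xss))"
  using assms
proof (induction xss)
  case Nil
  show ?case by (auto simp: jordan_matrix_def)
next
  case (Cons xs xss)
  let ?B = "jordan_matrix (map (\<lambda>xs. (length xs, c)) xss)"
  let ?n = "length xs" and ?m = "length (concat xss)"
  have dim: "dim_row ?B = ?m" "dim_col ?B = ?m"
    by (simp_all add: length_concat comp_def)
  then have B: "?B \<in> carrier_mat ?m ?m" by auto
  have step: "jordan_matrix (map (\<lambda>xs. (length xs, c)) (xs # xss)) =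
      four_block_mat (jordan_block ?n c) (0\<^sub>m ?n ?m) (0\<^sub>m ?m ?n) ?B"
    using dim by (simp add: jordan_matrix_def Let_def)
  have "vec_of_list (map f xs) \<in> carrier_vec ?n" "vec_of_list (map f (concat xss)) \<in> carrier_vec ?m"
    by (auto simp del: vec_of_list_map intro!: carrier_vecI)
  then have "jordan_matrix (map (\<lambda>xs. (length xs, c)) (xs # xss)) *\<^sub>v
        (vec_of_list (map f xs) @\<^sub>v vec_of_list (map f (concat xss))) =
      (jordan_block ?n c *\<^sub>v vec_of_list (map f xs)) @\<^sub>v (?B *\<^sub>v vec_of_list (map f (concat xss)))"
    unfolding step by (intro mult_mat_vec_split B) auto
  also have "jordan_block ?n c *\<^sub>v vec_of_list (map f xs) = vec_of_list (map (\<lambda>v. c * f v + s v) xs)"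
  proof -
    have "jordan_block ?n c *\<^sub>v vec_of_list (map f xs) =
        vec ?n (\<lambda>i. c * f (xs ! i) + (if Suc i < ?n then f (xs ! Suc i) else 0))"
      using jordan_block_mult_vec[of "map f xs" c] by (auto simp del: vec_of_list_map)
    also have "\<dots> = vec_of_list (map (\<lambda>v. c * f v + s v) xs)"
      by (rule eq_vecI) (auto simp: vec_of_list_index Cons.prems simp del: vec_of_list_map)
    finally show ?thesis .
  qed
  also have "?B *\<^sub>v vec_of_list (map f (concat xss)) = vec_of_list (map (\<lambda>v. c * f v + s v) (concat xss))"
    by (rule Cons.IH) (simp add: Cons.prems)
  finally show ?case
    by (simp only: concat.simps map_append vec_of_list_append)
qed

section \<open>Minors of a matrix with two columns\<close>

lemma det_mat_2:
  fixes A :: "'a::comm_ring_1 mat"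
  assumes "A \<in> carrier_mat 2 2"
  shows "det A = A $$ (0,0) * A $$ (1,1) - A $$ (1,0) * A $$ (0,1)"
proof -
  have d: "det A = (\<Sum>i<2. A $$ (i,0) * cofactor A i 0)"
    using laplace_expansion_column[OF assms, of 0] by simp
  have "mat_delete A i 0 \<in> carrier_mat 1 1" for i
    using assms by (auto simp: mat_delete_def)
  then have "cofactor A 0 0 = A $$ (1,1)" "cofactor A 1 0 = - A $$ (0,1)"
    unfolding cofactor_def using assms by (auto simp: det_single mat_delete_def)
  then show ?thesis unfolding d by (simp add: numeral_2_eq_2)
qed

text \<open>Two columns leave \<open>{0,1}\<close> as the only column set, and \<open>pick\<close>
  lists a two-element row set in increasing order, which fixes the sign of each minor.\<close>

lemma minors_2_two_columns:
  fixes A :: "'a::comm_ring_1 mat"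
  assumes A: "dim_col A = 2"
  shows "minors 2 A = {A $$ (p,0) * A $$ (q,1) - A $$ (q,0) * A $$ (p,1) | p q. p < q \<and> q < dim_row A}"
proof -
  have det: "det (submatrix A P {0,1}) =
      A $$ (pick P 0,0) * A $$ (pick P 1,1) - A $$ (pick P 1,0) * A $$ (pick P 0,1)"
    if P: "P \<subseteq> {0..<dim_row A}" "card P = 2" for P
  proof -
    have rows: "{i. i < dim_row A \<and> i \<in> P} = P" and cols: "{j. j < dim_col A \<and> j \<in> {0,1}} = {0,1}"
      using P A by auto
    have pick0: "pick {0,1} 0 = 0" "pick {0,1} (Suc 0) = Suc 0"
      by (auto intro!: Least_equality)
    have "submatrix A P {0,1} \<in> carrier_mat 2 2"
      using dim_submatrix[of A P "{0,1}"] unfolding rows cols by (auto simp: P)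
    moreover have "submatrix A P {0,1} $$ (i,j) = A $$ (pick P i, j)" if "i < 2" "j < 2" for i j
    proof -
      have "submatrix A P {0,1} $$ (i,j) = A $$ (pick P i, pick {0,1} j)"
        using that by (intro submatrix_index) (simp_all only: rows cols P, auto)
      also have "pick {0,1} j = j"
        using that(2) pick0 by (cases j) (auto simp: less_2_cases_iff simp del: pick.simps)
      finally show ?thesis .
    qed
    ultimately show ?thesis by (simp add: det_mat_2)
  qed
  have Q: "Q = {0,1}" if "Q \<subseteq> {0..<2}" "card Q = 2" for Q :: "nat set"
  proof -
    have "Q = {0..<2}" using that by (intro card_subset_eq) auto
    then show ?thesis by auto
  qed
  show ?thesis
  proof (intro equalityI subsetI)
    fix x assume "x \<in> minors 2 A"
    then obtain P where P: "P \<subseteq> {0..<dim_row A}" "card P = 2" and x: "x = det (submatrix A P {0,1})"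
      unfolding minors_def A using Q by blast
    have "pick P 0 < pick P 1" "pick P 1 \<in> P"
      using P(2) by (auto intro!: pick_mono_le pick_in_set_le simp del: pick.simps)
    then show "x \<in> {A $$ (p,0) * A $$ (q,1) - A $$ (q,0) * A $$ (p,1) | p q. p < q \<and> q < dim_row A}"
      unfolding x det[OF P] using P(1) by fastforce
  next
    fix x assume "x \<in> {A $$ (p,0) * A $$ (q,1) - A $$ (q,0) * A $$ (p,1) | p q. p < q \<and> q < dim_row A}"
    then obtain p q where pq: "p < q" "q < dim_row A"
      and x: "x = A $$ (p,0) * A $$ (q,1) - A $$ (q,0) * A $$ (p,1)" by blast
    have P: "{p,q} \<subseteq> {0..<dim_row A}" "card {p,q} = 2" using pq by auto
    have "pick {p,q} 0 = p" using pq by (auto intro!: Least_equality)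
    moreover have "pick {p,q} 0 < pick {p,q} 1" "pick {p,q} 1 \<in> {p,q}"
      by (rule pick_mono_le pick_in_set_le; simp add: P)+
    ultimately have "pick {p,q} 0 = p" "pick {p,q} 1 = q"
      by (metis, metis insertE less_irrefl singletonD)
    then have "x = det (submatrix A {p,q} {0,1})" unfolding det[OF P] x by simp
    moreover have "{0,1} \<subseteq> {0..<dim_col A}" "card {0,1::nat} = 2" by (auto simp: A)
    ultimately show "x \<in> minors 2 A" unfolding minors_def using P by blast
  qed
qed

text \<open>The row of \<open>J\<^sub>\<lambda> x\<close> with index \<open>i\<close> is \<open>\<lambda> x(i) + next_var r i\<close>; the multiple of \<open>x(i)\<close>
  cancels in the minors.\<close>

definition next_var :: "(nat \<Rightarrow> nat) \<Rightarrow> idx \<Rightarrow> (idx, 'a::comm_ring_1) mpoly" where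
  "next_var r i = (if snd (snd i) < r (fst i) then var (idx_succ i) else 0)"

lemma dim_Jx_x_mat: "dim_row (Jx_x_mat l k r c) = length (Lam_list l k r)"
  "dim_col (Jx_x_mat l k r c) = 2"
  by (simp_all add: Jx_x_mat_def)

lemma J_mat_mult_var_vec:
  "map_mat const_poly (J_mat l k r c) *\<^sub>v var_vec l k r =
    vec_of_list (map (\<lambda>i. const_poly c * var i + next_var r i) (Lam_list l k r))"
proof -
  \<comment> \<open>One list of row indices per Jordan block, in the order of the blocks of
    \<open>J_mat\<close>; its concatenation is \<open>Lam_list\<close>.\<close>
  define xss where "xss = concat (map (\<lambda>i1. map (\<lambda>i2. map (\<lambda>i3. (i1, i2, i3)) [1..<Suc (r i1)])
    [1..<Suc (k i1)]) [1..<Suc l])"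
  have concat_concat: "concat (map concat yss) = concat (concat yss)" for yss :: "idx list list list"
    by (induction yss) auto
  have xss: "Lam_list l k r = concat xss"
    by (simp add: Lam_list_def xss_def comp_def flip: concat_concat del: upt_Suc)
  have bs: "concat (map (\<lambda>i. replicate (k i) (r i, c)) [1..<Suc l]) = map (\<lambda>xs. (length xs, c)) xss"
    by (simp add: xss_def map_concat comp_def map_replicate_const del: upt_Suc)
  have J: "map_mat const_poly (J_mat l k r c) =
      jordan_matrix (map (\<lambda>xs. (length xs, const_poly c)) xss)"
    unfolding J_mat_def bs
    by (subst map_mat_jordan_matrix) (simp_all add: const_poly_def comp_def)
  have nv: "next_var r (xs ! p) = (if Suc p < length xs then var (xs ! Suc p) else 0)"
    if "xs \<in> set xss" "p < length xs" for xs p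
    using that by (auto simp: xss_def next_var_def simp del: upt_Suc)
  show ?thesis
    unfolding J var_vec_def xss by (rule jordan_matrix_mult_vec) (rule nv)
qed

text \<open>The eigenvalue \<open>c\<close> is gone from the right-hand side, so the ideal does not
  depend on it. Row positions become indices because \<open>Lam_list\<close> is strictly
  sorted.\<close>

lemma minors_Jx_x:
  "minors 2 (Jx_x_mat l k r c) =
    {next_var r i * var j - var i * next_var r j | i j.
      i \<in> Lam l k r \<and> j \<in> Lam l k r \<and> idx_greater i j}"
proof -
  let ?L = "Lam_list l k r"
  have row: "Jx_x_mat l k r c $$ (p,0) = const_poly c * var (?L ! p) + next_var r (?L ! p)"
    "Jx_x_mat l k r c $$ (p,1) = var (?L ! p)" if "p < length ?L" for p
    using that unfolding Jx_x_mat_def J_mat_mult_var_vec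
    by (simp_all add: mat_of_cols_index vec_of_list_index var_vec_def del: vec_of_list_map)
  have eq: "Jx_x_mat l k r c $$ (p,0) * Jx_x_mat l k r c $$ (q,1) -
      Jx_x_mat l k r c $$ (q,0) * Jx_x_mat l k r c $$ (p,1) =
      next_var r (?L ! p) * var (?L ! q) - var (?L ! p) * next_var r (?L ! q)"
    if "p < q" "q < length ?L" for p q
    using that by (simp only: row less_trans) (simp add: algebra_simps)
  have gt: "idx_greater (?L ! p) (?L ! q)" if "p < q" "q < length ?L" for p q
    using sorted_Lam_list[of l k r] that by (simp add: sorted_wrt_iff_nth_less)
  have asym: "\<not> (idx_greater i j \<and> idx_greater j i)" "\<not> idx_greater i i" for i j
    by (cases i; cases j; auto)+
  have nth: "i \<in> Lam l k r \<longleftrightarrow> (\<exists>p < length ?L. i = ?L ! p)" for i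
    unfolding set_Lam_list[symmetric] in_set_conv_nth by auto
  \<comment> \<open>Converse of \<open>gt\<close>: sortedness and asymmetry of
    \<open>idx_greater\<close> rule out the other orders of positions.\<close>
  have lt: "p < q" if "idx_greater (?L ! p) (?L ! q)" "p < length ?L" for p q
    using that gt[of q p] asym by (metis linorder_neqE_nat)
  show ?thesis
    unfolding minors_2_two_columns[OF dim_Jx_x_mat(2)] dim_Jx_x_mat(1)
  proof (intro equalityI subsetI; clarify)
    fix p q assume pq: "p < q" "q < length ?L"
    then have "?L ! p \<in> Lam l k r" "?L ! q \<in> Lam l k r" unfolding nth using less_trans by blast+
    then show "\<exists>i j. Jx_x_mat l k r c $$ (p,0) * Jx_x_mat l k r c $$ (q,1) -
        Jx_x_mat l k r c $$ (q,0) * Jx_x_mat l k r c $$ (p,1) =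
        next_var r i * var j - var i * next_var r j \<and>
        i \<in> Lam l k r \<and> j \<in> Lam l k r \<and> idx_greater i j"
      using eq[OF pq] gt[OF pq] by blast
  next
    fix i1 i2 i3 j1 j2 j3
    assume ij: "(i1,i2,i3) \<in> Lam l k r" "(j1,j2,j3) \<in> Lam l k r" "idx_greater (i1,i2,i3) (j1,j2,j3)"
    then obtain p q where pq: "p < length ?L" "(i1,i2,i3) = ?L ! p" "q < length ?L" "(j1,j2,j3) = ?L ! q"
      unfolding nth by blast
    then have "p < q" using lt ij(3) by simp
    from eq[OF this pq(3)] \<open>p < q\<close> pq(3)
    show "\<exists>p q. next_var r (i1,i2,i3) * var (j1,j2,j3) - var (i1,i2,i3) * next_var r (j1,j2,j3) =
        Jx_x_mat l k r c $$ (p,0) * Jx_x_mat l k r c $$ (q,1) -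
        Jx_x_mat l k r c $$ (q,0) * Jx_x_mat l k r c $$ (p,1) \<and> p < q \<and> q < length ?L"
      unfolding pq by metis
  qed
qed

section \<open>Monomials, leading monomials and polynomial ideals\<close>

text \<open>Used for the monomials of a polynomial, and with the reversed order for the variables at
  which two monomials differ.\<close>

lemma finite_strict_greatest:
  assumes "finite A" "A \<noteq> {}"
    and trans: "\<And>x y z. gt x y \<Longrightarrow> gt y z \<Longrightarrow> gt x z"
    and total: "\<And>x y. x \<noteq> y \<Longrightarrow> gt x y \<or> gt y x"
  shows "\<exists>m\<in>A. \<forall>x\<in>A. x \<noteq> m \<longrightarrow> gt m x"
  using assms(1,2)
proof (induction rule: finite_ne_induct)
  case (insert x F)
  then obtain m where "m \<in> F" "\<forall>y\<in>F. y \<noteq> m \<longrightarrow> gt m y" by blast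
  then show ?case using total[of x m] trans by (metis insert_iff)
qed simp

section \<open>Graded reverse lexicographic order as a strict total order\<close>

lemma grevlex_irrefl: "\<not> grevlex_greater gt s s"
  by (simp add: grevlex_greater_def)

lemma grevlex_trans:
  assumes "\<And>x y z. gt x y \<Longrightarrow> gt y z \<Longrightarrow> gt x z"
    and "\<And>x y. x \<noteq> y \<Longrightarrow> gt x y \<or> gt y x"
    and "grevlex_greater gt s t" "grevlex_greater gt t u"
  shows "grevlex_greater gt s u"
proof (cases "total_degree s = total_degree t \<and> total_degree t = total_degree u")
  case True
  then obtain v w where
      v: "Poly_Mapping.lookup s v < Poly_Mapping.lookup t v"
        "\<And>x. gt v x \<Longrightarrow> Poly_Mapping.lookup s x = Poly_Mapping.lookup t x"
    and w: "Poly_Mapping.lookup t w < Poly_Mapping.lookup u w"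
        "\<And>x. gt w x \<Longrightarrow> Poly_Mapping.lookup t x = Poly_Mapping.lookup u x"
    using assms(3,4) unfolding grevlex_greater_def by auto
  \<comment> \<open>The smaller of the two deciding variables: below it all three monomials
    agree.\<close>
  define x where "x = (if gt v w then w else v)"
  have x: "x = v \<and> v = w \<or> x = v \<and> gt w v \<or> x = w \<and> gt v w"
    using assms(2)[of v w] by (auto simp: x_def)
  then have "Poly_Mapping.lookup s x < Poly_Mapping.lookup u x"
    using v w by auto
  moreover have "Poly_Mapping.lookup s y = Poly_Mapping.lookup u y" if "gt x y" for y
    using x that v(2)[of y] w(2)[of y] assms(1)[of v w y] assms(1)[of w v y] by auto
  ultimately have "\<exists>v. Poly_Mapping.lookup s v < Poly_Mapping.lookup u v \<and>
      (\<forall>x. gt v x \<longrightarrow> Poly_Mapping.lookup s x = Poly_Mapping.lookup u x)"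
    by blast
  then show ?thesis unfolding grevlex_greater_def using True by simp
qed (use assms(3,4) in \<open>auto simp: grevlex_greater_def\<close>)

lemma grevlex_total:
  assumes "\<And>x y z. gt x y \<Longrightarrow> gt y z \<Longrightarrow> gt x z"
    and "\<And>x y. x \<noteq> y \<Longrightarrow> gt x y \<or> gt y x" "\<And>x. \<not> gt x x"
    and "s \<noteq> t"
  shows "grevlex_greater gt s t \<or> grevlex_greater gt t s"
proof -
  let ?D = "{v. Poly_Mapping.lookup s v \<noteq> Poly_Mapping.lookup t v}"
  have "finite ?D"
    by (rule finite_subset[of _ "Poly_Mapping.keys s \<union> Poly_Mapping.keys t"])
      (auto simp: in_keys_iff)
  moreover have "?D \<noteq> {}" using assms(4) by (auto intro: poly_mapping_eqI)
  \<comment> \<open>Greatest for the reversed order means the smallest variable at which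
    \<open>s\<close> and \<open>t\<close> differ, which is the one that decides.\<close>
  ultimately have "\<exists>v\<in>?D. \<forall>x\<in>?D. x \<noteq> v \<longrightarrow> gt x v"
    by (rule finite_strict_greatest[where gt = "\<lambda>x y. gt y x"]) (use assms(1,2) in blast)+
  then obtain v where v: "Poly_Mapping.lookup s v \<noteq> Poly_Mapping.lookup t v"
    and "\<forall>x\<in>?D. x \<noteq> v \<longrightarrow> gt x v" by blast
  then have eq: "Poly_Mapping.lookup s x = Poly_Mapping.lookup t x" if "gt v x" for x
    using that assms(1)[of x v x] assms(3)[of x] by auto
  show ?thesis
    using v eq unfolding grevlex_greater_def by (metis linorder_neqE_nat)
qed

lemma idx_greater_irrefl: "\<not> idx_greater i i"
  by (cases i) auto

lemma idx_greater_trans: "idx_greater i j \<Longrightarrow> idx_greater j k \<Longrightarrow> idx_greater i k"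
  by (cases i; cases j; cases k) auto

lemma idx_greater_total: "i \<noteq> j \<Longrightarrow> idx_greater i j \<or> idx_greater j i"
  by (cases i; cases j) auto

lemma idx_grevlex_trans:
  "grevlex_greater idx_greater s t \<Longrightarrow> grevlex_greater idx_greater t u \<Longrightarrow>
    grevlex_greater idx_greater s u"
  by (rule grevlex_trans[OF idx_greater_trans idx_greater_total])

lemma idx_grevlex_total:
  "s \<noteq> t \<Longrightarrow> grevlex_greater idx_greater s t \<or> grevlex_greater idx_greater t s"
  by (rule grevlex_total[OF idx_greater_trans idx_greater_total idx_greater_irrefl])

section \<open>Leading monomials\<close>

lemma leading_monom_eqI:
  assumes "m \<in> Poly_Mapping.keys p"
    and "\<And>m'. m' \<in> Poly_Mapping.keys p \<Longrightarrow> m' \<noteq> m \<Longrightarrow> grevlex_greater idx_greater m m'"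
  shows "leading_monom (grevlex_greater idx_greater) p = m"
  unfolding leading_monom_def
proof (rule the_equality)
  fix m' assume "m' \<in> Poly_Mapping.keys p \<and>
    (\<forall>n\<in>Poly_Mapping.keys p. n \<noteq> m' \<longrightarrow> grevlex_greater idx_greater m' n)"
  then show "m' = m"
    using assms idx_grevlex_trans[of m m' m] grevlex_irrefl[of idx_greater m] by metis
qed (use assms in blast)

lemma leading_monom_greatest:
  assumes "p \<noteq> 0"
  defines "m \<equiv> leading_monom (grevlex_greater idx_greater) p"
  shows "m \<in> Poly_Mapping.keys p"
    and "\<And>m'. m' \<in> Poly_Mapping.keys p \<Longrightarrow> m' \<noteq> m \<Longrightarrow> grevlex_greater idx_greater m m'"
proof -
  have "Poly_Mapping.keys p \<noteq> {}" using assms(1) by simp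
  then have "\<exists>n\<in>Poly_Mapping.keys p. \<forall>m'\<in>Poly_Mapping.keys p. m' \<noteq> n \<longrightarrow>
      grevlex_greater idx_greater n m'"
    by (rule finite_strict_greatest[OF finite_keys _ idx_grevlex_trans idx_grevlex_total])
  then obtain n where n: "n \<in> Poly_Mapping.keys p"
    "\<forall>m'\<in>Poly_Mapping.keys p. m' \<noteq> n \<longrightarrow> grevlex_greater idx_greater n m'"
    by blast
  then have "m = n" unfolding m_def by (intro leading_monom_eqI) auto
  then show "m \<in> Poly_Mapping.keys p"
    and "\<And>m'. m' \<in> Poly_Mapping.keys p \<Longrightarrow> m' \<noteq> m \<Longrightarrow> grevlex_greater idx_greater m m'"
    using n by auto
qed

section \<open>Weighted degrees of monomials\<close>

definition wdeg :: "('v \<Rightarrow> nat) \<Rightarrow> 'v monom \<Rightarrow> nat" where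
  "wdeg w m = (\<Sum>v \<in> Poly_Mapping.keys m. w v * Poly_Mapping.lookup m v)"

text \<open>The block degrees and the shift degree below are weighted degrees too, so additivity is
  proved once for all of them.\<close>

lemma total_degree_eq_wdeg: "total_degree = wdeg (\<lambda>_. 1)"
  by (rule ext) (simp add: total_degree_def wdeg_def)

lemma wdeg_superset:
  "finite A \<Longrightarrow> Poly_Mapping.keys m \<subseteq> A \<Longrightarrow> wdeg w m = (\<Sum>v\<in>A. w v * Poly_Mapping.lookup m v)"
  unfolding wdeg_def by (intro sum.mono_neutral_left) (auto simp: in_keys_iff)

lemma wdeg_add: "wdeg w (s + t) = wdeg w s + wdeg w t"
proof -
  let ?A = "Poly_Mapping.keys s \<union> Poly_Mapping.keys t"
  have A: "finite ?A" "Poly_Mapping.keys s \<subseteq> ?A" "Poly_Mapping.keys t \<subseteq> ?A" by auto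
  show ?thesis
    unfolding wdeg_superset[OF A(1) Poly_Mapping.keys_add] wdeg_superset[OF A(1,2)]
      wdeg_superset[OF A(1,3)]
    by (simp add: lookup_add distrib_left sum.distrib)
qed

lemma wdeg_single [simp]: "wdeg w (Poly_Mapping.single v n) = w v * n"
  by (simp add: wdeg_def)

text \<open>Once one variable exhausts a weighted degree, this forces exponent 0 at every other
  variable of positive weight.\<close>

lemma wdeg_two_le:
  assumes "u \<noteq> v"
  shows "w u * Poly_Mapping.lookup m u + w v * Poly_Mapping.lookup m v \<le> wdeg w m"
proof -
  let ?A = "Poly_Mapping.keys m \<union> {u, v}"
  have "w u * Poly_Mapping.lookup m u + w v * Poly_Mapping.lookup m v =
      (\<Sum>v\<in>{u, v}. w v * Poly_Mapping.lookup m v)"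
    using assms by simp
  also have "\<dots> \<le> (\<Sum>v\<in>?A. w v * Poly_Mapping.lookup m v)" by (rule sum_mono2) auto
  also have "\<dots> = wdeg w m" by (rule wdeg_superset[symmetric]) auto
  finally show ?thesis .
qed

lemma wdeg_ge: "w v * Poly_Mapping.lookup m v \<le> wdeg w m"
proof -
  have "w v * Poly_Mapping.lookup m v = (\<Sum>v\<in>{v}. w v * Poly_Mapping.lookup m v)" by simp
  also have "\<dots> \<le> (\<Sum>v\<in>Poly_Mapping.keys m \<union> {v}. w v * Poly_Mapping.lookup m v)"
    by (rule sum_mono2) auto
  also have "\<dots> = wdeg w m" by (rule wdeg_superset[symmetric]) auto
  finally show ?thesis .
qed

text \<open>Natural exponents cannot cancel, which turns the general inclusion
  \<open>keys_add\<close> into an equality.\<close>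

lemma keys_add_monom: "Poly_Mapping.keys (s + t) = Poly_Mapping.keys s \<union> Poly_Mapping.keys t"
  for s t :: "'v monom"
  by (auto simp: in_keys_iff lookup_add)

lemma monom_poly_mult: "monom_poly s * monom_poly t = (monom_poly (s + t) :: ('v, 'a::comm_ring_1) mpoly)"
  by (simp add: monom_poly_def mult_single)

lemma keys_monom_poly [simp]: "Poly_Mapping.keys (monom_poly m :: ('v, 'a::zero_neq_one) mpoly) = {m}"
  by (simp add: monom_poly_def)

lemma var_mult: "var v * var w =
    (monom_poly (Poly_Mapping.single v 1 + Poly_Mapping.single w 1) :: ('v, 'a::comm_ring_1) mpoly)"
  by (simp add: var_def monom_poly_mult)

lemma monom_poly_in_poly_ring [simp]:
  "monom_poly m \<in> carrier (poly_ring V) \<longleftrightarrow> Poly_Mapping.keys m \<subseteq> V"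
  by (simp add: poly_ring_simps)

lemma var_in_poly_ring [simp]: "var v \<in> carrier (poly_ring V) \<longleftrightarrow> v \<in> V"
  by (simp add: var_def)

section \<open>Ideals of the polynomial ring\<close>

lemma poly_ring_ring: "ring (poly_ring V)"
  using cring.axioms(1)[OF poly_ring_cring] .

lemma poly_ideal_generated:
  "S \<subseteq> carrier (poly_ring V) \<Longrightarrow> ideal (Idl\<^bsub>poly_ring V\<^esub> S) (poly_ring V)"
  using ring.genideal_ideal[OF poly_ring_ring] .

context
  fixes V :: "'v set" and I :: "('v, 'a::comm_ring_1) mpoly set"
  assumes I: "ideal I (poly_ring V)"
begin

lemma poly_ideal_subset: "p \<in> I \<Longrightarrow> p \<in> carrier (poly_ring V)"
  using ideal.Icarr[OF I] .

lemma poly_ideal_zero: "0 \<in> I"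
  using additive_subgroup.zero_closed[OF ideal.axioms(1)[OF I]] by (simp add: poly_ring_simps)

lemma poly_ideal_add: "p \<in> I \<Longrightarrow> q \<in> I \<Longrightarrow> p + q \<in> I"
  using additive_subgroup.a_closed[OF ideal.axioms(1)[OF I]] by (simp add: poly_ring_simps)

lemma poly_ideal_mult: "p \<in> I \<Longrightarrow> h \<in> carrier (poly_ring V) \<Longrightarrow> h * p \<in> I"
  using ideal.I_l_closed[OF I] by (simp add: poly_ring_simps)

lemma poly_ideal_uminus: "p \<in> I \<Longrightarrow> - p \<in> I"
  using poly_ideal_mult[of p "-1"] by (simp add: poly_ring_simps)

lemma poly_ideal_diff: "p \<in> I \<Longrightarrow> q \<in> I \<Longrightarrow> p - q \<in> I"
  using poly_ideal_add[OF _ poly_ideal_uminus] by fastforce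

end

text \<open>For \<open>S\<close> a fibre of a map from monomials to monomials, this is one
  coefficient of the image of \<open>p\<close>. It stands in for the target ring, which is never
  constructed.\<close>

definition coeff_sum :: "'v monom set \<Rightarrow> ('v, 'a::comm_ring_1) mpoly \<Rightarrow> 'a" where
  "coeff_sum S p = (\<Sum>m \<in> Poly_Mapping.keys p. if m \<in> S then Poly_Mapping.lookup p m else 0)"

lemma coeff_sum_superset:
  "finite A \<Longrightarrow> Poly_Mapping.keys p \<subseteq> A \<Longrightarrow>
    coeff_sum S p = (\<Sum>m\<in>A. if m \<in> S then Poly_Mapping.lookup p m else 0)"
  unfolding coeff_sum_def by (intro sum.mono_neutral_left) (auto simp: in_keys_iff)

lemma coeff_sum_zero [simp]: "coeff_sum S 0 = 0"
  by (simp add: coeff_sum_def)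

lemma coeff_sum_single: "coeff_sum S (Poly_Mapping.single m c) = (if m \<in> S then c else 0)"
  by (simp add: coeff_sum_def)

lemma coeff_sum_add: "coeff_sum S (p + q) = coeff_sum S p + coeff_sum S q"
proof -
  let ?A = "Poly_Mapping.keys p \<union> Poly_Mapping.keys q"
  have A: "finite ?A" "Poly_Mapping.keys p \<subseteq> ?A" "Poly_Mapping.keys q \<subseteq> ?A" by auto
  have "coeff_sum S (p + q) =
      (\<Sum>m\<in>?A. (if m \<in> S then Poly_Mapping.lookup p m else 0) +
        (if m \<in> S then Poly_Mapping.lookup q m else 0))"
    unfolding coeff_sum_superset[OF A(1) Poly_Mapping.keys_add]
    by (rule sum.cong) (simp_all add: lookup_add)
  then show ?thesis
    by (simp only: sum.distrib coeff_sum_superset[OF A(1,2)] coeff_sum_superset[OF A(1,3)])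
qed

lemma coeff_sum_diff: "coeff_sum S (p - q) = coeff_sum S p - coeff_sum S q"
  using coeff_sum_add[of S "p - q" q] by (simp add: algebra_simps)

lemma coeff_sum_sum: "coeff_sum S (sum f A) = (\<Sum>x\<in>A. coeff_sum S (f x))"
  by (induction A rule: infinite_finite_induct) (simp_all add: coeff_sum_add)

text \<open>By linearity, since \<open>h\<close> is the sum of its terms.\<close>

lemma coeff_sum_mult_eq_0:
  assumes "\<And>n c. coeff_sum S (Poly_Mapping.single n c * g) = 0"
  shows "coeff_sum S (h * g) = 0"
proof -
  have "h = (\<Sum>n\<in>Poly_Mapping.keys h. Poly_Mapping.single n (Poly_Mapping.lookup h n))"
    by (rule poly_mapping_eqI)
      (simp add: lookup_sum lookup_single when_def in_keys_iff)
  then have "h * g = (\<Sum>n\<in>Poly_Mapping.keys h. Poly_Mapping.single n (Poly_Mapping.lookup h n) * g)"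
    by (metis sum_distrib_right)
  then show ?thesis by (simp add: coeff_sum_sum assms)
qed

text \<open>The functional \<open>coeff_sum S\<close> is only additive, so its kernel may fail to be
  an ideal. Asking for all multiples \<open>h * p\<close> repairs this, because
  \<open>h * (x * a) = (h * x) * a\<close>.\<close>

lemma ideal_coeff_sum_annihilator:
  fixes S :: "'v monom set"
  shows "ideal {p \<in> carrier (poly_ring V). \<forall>h. coeff_sum S (h * p) = 0}
    (poly_ring V :: ('v, 'a::comm_ring_1) mpoly ring)"
proof -
  interpret cring "poly_ring V :: ('v, 'a) mpoly ring" by (rule poly_ring_cring)
  let ?Z = "{p \<in> carrier (poly_ring V). \<forall>h. coeff_sum S (h * p) = 0} :: ('v, 'a) mpoly set"
  have closed: "x + y \<in> carrier (poly_ring V)" "x * y \<in> carrier (poly_ring V)"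
    if "x \<in> carrier (poly_ring V)" "y \<in> carrier (poly_ring V)" for x y :: "('v, 'a) mpoly"
    using a_closed[OF that] m_closed[OF that] by (simp_all add: poly_ring_simps)
  have minus: "\<ominus>\<^bsub>poly_ring V\<^esub> p = - p" if "p \<in> carrier (poly_ring V)" for p :: "('v, 'a) mpoly"
    using that by (intro minus_equality) (simp_all add: poly_ring_simps)
  have Z: "p \<in> ?Z \<longleftrightarrow> p \<in> carrier (poly_ring V) \<and> (\<forall>h. coeff_sum S (h * p) = 0)" for p
    by simp
  have Z_mult: "x * a \<in> ?Z" if "a \<in> ?Z" "x \<in> carrier (poly_ring V)" for a x
    using that closed(2)[of x a] unfolding Z mult.assoc[symmetric] by blast
  have Z_minus: "- a \<in> ?Z" if "a \<in> ?Z" for a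
    using Z_mult[OF that, of "-1"] by (simp add: poly_ring_simps(1))
  have Z_add: "a + b \<in> ?Z" if "a \<in> ?Z" "b \<in> ?Z" for a b
    using that closed(1)[of a b] unfolding Z by (simp add: distrib_left coeff_sum_add)
  show ?thesis
  proof (rule idealI)
    show "ring (poly_ring V :: ('v, 'a) mpoly ring)" by (rule ring_axioms)
    show "subgroup ?Z (add_monoid (poly_ring V))"
    proof (rule subgroup.intro)
      show "?Z \<subseteq> carrier (add_monoid (poly_ring V))" by auto
      show "\<one>\<^bsub>add_monoid (poly_ring V)\<^esub> \<in> ?Z" by (simp add: poly_ring_simps)
      fix x assume x: "x \<in> ?Z"
      then have "\<ominus>\<^bsub>poly_ring V\<^esub> x \<in> ?Z" using Z_minus[OF x] minus[of x] by simp
      then show "inv\<^bsub>add_monoid (poly_ring V)\<^esub> x \<in> ?Z" by (simp add: a_inv_def)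
      fix y assume "y \<in> ?Z"
      then show "x \<otimes>\<^bsub>add_monoid (poly_ring V)\<^esub> y \<in> ?Z"
        using Z_add[OF x, of y] by (simp add: poly_ring_simps(3))
    qed
    fix a x :: "('v, 'a) mpoly" assume "a \<in> ?Z" "x \<in> carrier (poly_ring V)"
    then have "x * a \<in> ?Z" by (rule Z_mult)
    then show "x \<otimes>\<^bsub>poly_ring V\<^esub> a \<in> ?Z" "a \<otimes>\<^bsub>poly_ring V\<^esub> x \<in> ?Z"
      by (simp_all only: poly_ring_simps(2) mult.commute)
  qed
qed

section \<open>Standard monomials are minimal in their fibres\<close>

text \<open>The exponent of u_(a,b) in the image monomial.\<close>

definition block_deg :: "nat \<Rightarrow> nat \<Rightarrow> idx monom \<Rightarrow> nat" where
  "block_deg a b = wdeg (\<lambda>(i1, i2, i3). if i1 = a \<and> i2 = b then 1 else 0)"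

text \<open>The exponent of s in the image monomial, before truncation. On \<open>Lam\<close> third
  indices start at 1, so the subtraction is exact there.\<close>

definition shift_deg :: "idx monom \<Rightarrow> nat" where
  "shift_deg = wdeg (\<lambda>(i1, i2, i3). i3 - 1)"

text \<open>The monomials with the same image as \<open>m0\<close> under \<open>x(a,b,c) \<mapsto> u\<^bsub>a,b\<^esub> s\<^bsup>c-1\<^esup>\<close>. The total degree is
  determined by the block degrees; it is included to have it at hand for the monomial order.\<close>

definition fibre :: "idx set \<Rightarrow> idx monom \<Rightarrow> idx monom set" where
  "fibre K m0 = {m. Poly_Mapping.keys m \<subseteq> K \<and> total_degree m = total_degree m0 \<and>
     (\<forall>a b. block_deg a b m = block_deg a b m0) \<and> shift_deg m = shift_deg m0}"

lemma deg_add: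
  "total_degree (p + q) = total_degree p + total_degree q"
  "block_deg a b (s + t) = block_deg a b s + block_deg a b t"
  "shift_deg (s + t) = shift_deg s + shift_deg t"
  by (simp_all add: total_degree_eq_wdeg block_deg_def shift_deg_def wdeg_add)

lemma deg_single:
  "total_degree (Poly_Mapping.single v n) = n"
  "block_deg a b (Poly_Mapping.single (i1, i2, i3) n) = (if i1 = a \<and> i2 = b then n else 0)"
  "shift_deg (Poly_Mapping.single (i1, i2, i3) n) = (i3 - 1) * n"
  by (simp_all add: total_degree_eq_wdeg block_deg_def shift_deg_def)

text \<open>Not divisible by \<open>x(i\<^sup>+) x(v)\<close> for any \<open>i > v\<close>; the case \<open>v = i\<^sup>+\<close> excludes squares.\<close>

definition standard :: "idx monom \<Rightarrow> bool" where
  "standard m \<longleftrightarrow> (\<forall>a b c v. (a, b, Suc c) \<in> Poly_Mapping.keys m \<longrightarrow> 1 \<le> c \<longrightarrow>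
     v \<in> Poly_Mapping.keys m \<longrightarrow> idx_greater (a, b, c) v \<longrightarrow>
     v = (a, b, Suc c) \<and> Poly_Mapping.lookup m v = 1)"

text \<open>In each block only the exponent at third index 1 is left open, and the block degree
  determines it. The type also admits third index 0, which \<open>pos\<close> excludes.\<close>

lemma monom_eqI:
  assumes pos: "\<And>a b c. (a, b, c) \<in> Poly_Mapping.keys m \<union> Poly_Mapping.keys n \<Longrightarrow> 1 \<le> c"
    and agree: "\<And>a b c. 2 \<le> c \<Longrightarrow> Poly_Mapping.lookup m (a, b, c) = Poly_Mapping.lookup n (a, b, c)"
    and block: "\<And>a b. block_deg a b m = block_deg a b n"
  shows "m = n"
proof (rule poly_mapping_eqI)
  fix v :: idx
  obtain a b c where v: "v = (a, b, c)" by (cases v) auto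
  consider "c = 0" | "c = 1" | "2 \<le> c" by linarith
  then show "Poly_Mapping.lookup m v = Poly_Mapping.lookup n v"
  proof cases
    case 1
    then have "v \<notin> Poly_Mapping.keys m" "v \<notin> Poly_Mapping.keys n"
      using pos[of a b c] v by auto
    then show ?thesis by (simp add: in_keys_iff)
  next
    case 2
    let ?A = "insert v (Poly_Mapping.keys m \<union> Poly_Mapping.keys n)"
    let ?w = "\<lambda>(i1, i2, i3). if i1 = a \<and> i2 = b then 1 else 0 :: nat"
    have split: "block_deg a b p = Poly_Mapping.lookup p v + (\<Sum>u\<in>?A - {v}. ?w u * Poly_Mapping.lookup p u)"
      if "Poly_Mapping.keys p \<subseteq> ?A" for p
    proof -
      have "block_deg a b p = (\<Sum>u\<in>?A. ?w u * Poly_Mapping.lookup p u)"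
        unfolding block_deg_def using that by (intro wdeg_superset) auto
      also have "\<dots> = ?w v * Poly_Mapping.lookup p v + (\<Sum>u\<in>?A - {v}. ?w u * Poly_Mapping.lookup p u)"
        by (intro sum.remove) auto
      finally show ?thesis by (simp add: v)
    qed
    have "?w u * Poly_Mapping.lookup m u = ?w u * Poly_Mapping.lookup n u" if u: "u \<in> ?A - {v}" for u
    proof -
      obtain a' b' c' where u': "u = (a', b', c')" by (cases u) auto
      then have "1 \<le> c'" using u pos by blast
      then show ?thesis using u agree[of c'] unfolding u' v 2 by auto
    qed
    then have "(\<Sum>u\<in>?A - {v}. ?w u * Poly_Mapping.lookup m u) = (\<Sum>u\<in>?A - {v}. ?w u * Poly_Mapping.lookup n u)"
      by (intro sum.cong) auto
    moreover have "Poly_Mapping.keys m \<subseteq> ?A" "Poly_Mapping.keys n \<subseteq> ?A" by auto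
    ultimately show ?thesis using split[of m] split[of n] block[of a b] by simp
  next
    case 3
    then show ?thesis using agree v by blast
  qed
qed

lemma block_deg_eq_0:
  assumes "\<And>c. (a, b, c) \<notin> Poly_Mapping.keys m"
  shows "block_deg a b m = 0"
  unfolding block_deg_def wdeg_def using assms by (auto intro!: sum.neutral)

lemma lookup_le_block_deg: "Poly_Mapping.lookup m (a, b, c) \<le> block_deg a b m"
  using wdeg_ge[of "\<lambda>(i1, i2, i3). if i1 = a \<and> i2 = b then 1 else 0" "(a, b, c)" m]
  by (simp add: block_deg_def)

lemma lookup_le_shift_deg: "(c - 1) * Poly_Mapping.lookup m (a, b, c) \<le> shift_deg m"
  using wdeg_ge[of "\<lambda>(i1, i2, i3). i3 - 1" "(a, b, c)" m] by (simp add: shift_deg_def)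

text \<open>A variable with third index at least 2 forbids every other variable after its
  predecessor in the order. Two such variables would exclude each other, so at most one occurs, and
  all others lie in its block or an earlier one.\<close>

lemma standard_cases:
  assumes std: "standard m"
    and pos: "\<And>a b c. (a, b, c) \<in> Poly_Mapping.keys m \<Longrightarrow> 1 \<le> c"
  obtains (flat) "\<And>a b c. (a, b, c) \<in> Poly_Mapping.keys m \<Longrightarrow> c = 1" "shift_deg m = 0"
  | (step) a b c where "2 \<le> c" "Poly_Mapping.lookup m (a, b, c) = 1" "shift_deg m = c - 1"
      "\<And>a' b' c'. (a', b', c') \<in> Poly_Mapping.keys m \<Longrightarrow> (a', b', c') \<noteq> (a, b, c) \<Longrightarrow>
        c' = 1 \<and> (a' < a \<or> a' = a \<and> b' \<le> b)"
proof (cases "\<forall>(a, b, c) \<in> Poly_Mapping.keys m. c = 1")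
  case True
  then have "shift_deg m = 0"
    unfolding shift_deg_def wdeg_def by (auto intro!: sum.neutral)
  then show thesis using flat True by blast
next
  case False
  then obtain a b c where abc: "(a, b, c) \<in> Poly_Mapping.keys m" "c \<noteq> 1" by blast
  then have c: "2 \<le> c" using pos[of a b c] by simp
  have std': "v = (a, b, c) \<and> Poly_Mapping.lookup m v = 1"
    if "(a, b, c) \<in> Poly_Mapping.keys m" "2 \<le> c" "v \<in> Poly_Mapping.keys m" "idx_greater (a, b, c - 1) v"
    for a b c v
  proof -
    have "Suc (c - 1) = c" "1 \<le> c - 1" using that(2) by simp_all
    then show ?thesis
      using std[unfolded standard_def, rule_format, of a b "c - 1" v] that by metis
  qed
  \<comment> \<open>Standardness with \<open>v\<close> equal to the variable itself, which excludes
    its square.\<close>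
  have one: "Poly_Mapping.lookup m (a, b, c) = 1"
    using std'[OF abc(1) c abc(1)] c by simp
  have others: "c' = 1 \<and> (a' < a \<or> a' = a \<and> b' \<le> b)"
    if v: "(a', b', c') \<in> Poly_Mapping.keys m" "(a', b', c') \<noteq> (a, b, c)" for a' b' c'
  proof -
    have 1: "\<not> idx_greater (a, b, c - 1) (a', b', c')"
      using std'[OF abc(1) c v(1)] v(2) by blast
    then have le: "a' < a \<or> a' = a \<and> b' \<le> b" by auto
    \<comment> \<open>With both exclusions the blocks coincide, and then \<open>c' < c\<close> as
      well as \<open>c < c'\<close>.\<close>
    have "\<not> 2 \<le> c'"
    proof
      assume c': "2 \<le> c'"
      then have "\<not> idx_greater (a', b', c' - 1) (a, b, c)"
        using std'[OF v(1) c' abc(1)] v(2) by metis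
      then show False using 1 le c c' by auto
    qed
    then show ?thesis using le pos[OF v(1)] by simp
  qed
  \<comment> \<open>All other variables have third index 1 and hence weight 0.\<close>
  have "shift_deg m = (\<Sum>v\<in>{(a, b, c)}. (case v of (i1, i2, i3) \<Rightarrow> i3 - 1) * Poly_Mapping.lookup m v)"
    unfolding shift_deg_def wdeg_def
    using others abc by (intro sum.mono_neutral_right) force+
  then have "shift_deg m = c - 1" using one by simp
  then show thesis using step c one others by blast
qed

text \<open>The shift degree of \<open>m\<close> is concentrated in at most one variable. A
  different monomial of the fibre has to spread it over other variables, and loses the exponent at
  this variable while agreeing with \<open>m\<close> at all smaller ones.\<close>

lemma standard_minimal:
  assumes std: "standard m"
    and pos: "\<And>a b c. (a, b, c) \<in> K \<Longrightarrow> 1 \<le> c" and m: "Poly_Mapping.keys m \<subseteq> K"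
    and m': "m' \<in> fibre K m" "m' \<noteq> m"
  shows "grevlex_greater idx_greater m' m"
proof -
  have keys: "1 \<le> c" if "(a, b, c) \<in> Poly_Mapping.keys m' \<union> Poly_Mapping.keys m" for a b c
    using that m m' pos unfolding fibre_def by blast
  have total: "total_degree m' = total_degree m"
    and block: "\<And>a b. block_deg a b m' = block_deg a b m"
    and shift: "shift_deg m' = shift_deg m"
    using m' unfolding fibre_def by auto
  have pos_m: "1 \<le> c" if "(a, b, c) \<in> Poly_Mapping.keys m" for a b c
    using that keys by blast
  show ?thesis
  proof (cases rule: standard_cases[OF std, case_names prem flat step])
    case (prem a b c)
    then show ?case by (rule pos_m)
  next
    case flat
    \<comment> \<open>Shift degree 0 leaves only variables of third index 1 in \<open>m'\<close>
      too, so the block degrees determine it.\<close>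
    have "Poly_Mapping.lookup m' (a, b, c) = Poly_Mapping.lookup m (a, b, c)" if "2 \<le> c" for a b c
    proof -
      have "Poly_Mapping.lookup m (a, b, c) = 0"
        using flat(1)[of a b c] that by (auto simp: in_keys_iff)
      moreover have "Poly_Mapping.lookup m' (a, b, c) = 0"
        using lookup_le_shift_deg[of c m' a b] that by (simp add: shift flat(2))
      ultimately show ?thesis by simp
    qed
    then have "m' = m" using keys block by (intro monom_eqI) auto
    with m'(2) show ?thesis by simp
  next
    case (step a b c)
    have zero: "Poly_Mapping.lookup m (a', b', c') = 0"
      if "(a', b', c') \<noteq> (a, b, c)" "2 \<le> c' \<or> a < a' \<or> a = a' \<and> b < b'" for a' b' c'
    proof -
      have "(a', b', c') \<notin> Poly_Mapping.keys m" using step(4)[of a' b' c'] that by auto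
      then show ?thesis by (simp add: in_keys_iff)
    qed
    \<comment> \<open>The whole shift degree is \<open>c - 1\<close>, shared by the two
      variables.\<close>
    have le: "(c - 1) * Poly_Mapping.lookup m' (a, b, c) +
        (c' - 1) * Poly_Mapping.lookup m' (a', b', c') \<le> c - 1"
      if "(a', b', c') \<noteq> (a, b, c)" for a' b' c'
      using wdeg_two_le[OF that[symmetric], of "\<lambda>(i1, i2, i3). i3 - 1" m'] shift step(3)
      by (simp add: shift_deg_def)
    have "(c - 1) * Poly_Mapping.lookup m' (a, b, c) \<le> (c - 1) * 1"
      using lookup_le_shift_deg[of c m' a b] shift step(3) by simp
    then have "Poly_Mapping.lookup m' (a, b, c) \<le> 1"
      using step(1) by (subst (asm) mult_le_cancel1) simp
    then consider "Poly_Mapping.lookup m' (a, b, c) = 0" | "Poly_Mapping.lookup m' (a, b, c) = 1"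
      by linarith
    then show ?thesis
    proof cases
      case 1
      \<comment> \<open>The variable \<open>(a, b, c)\<close> will decide the comparison. Below it
        both exponents are 0: further down the same block one variable would already exceed the
        shift degree \<open>c - 1\<close>, and later blocks have block degree 0.\<close>
      have "Poly_Mapping.lookup m' w = Poly_Mapping.lookup m w" if w: "idx_greater (a, b, c) w" for w
      proof -
        obtain a' b' c' where w': "w = (a', b', c')" by (cases w) auto
        show ?thesis
        proof (cases "a' = a \<and> b' = b")
          case True
          then have "c < c'" using w w' by simp
          then have ne: "(a', b', c') \<noteq> (a, b, c)" and c': "2 \<le> c'" "c - 1 < c' - 1"
            using step(1) by auto
          have "Poly_Mapping.lookup m' (a', b', c') = 0"
          proof (rule ccontr)
            assume "Poly_Mapping.lookup m' (a', b', c') \<noteq> 0"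
            then have "c' - 1 \<le> (c' - 1) * Poly_Mapping.lookup m' (a', b', c')" by simp
            then show False using le[OF ne] c'(2) by linarith
          qed
          then show ?thesis using zero[OF ne] c'(1) w' by simp
        next
          case False
          then have gt: "a < a' \<or> a = a' \<and> b < b'" using w w' by auto
          then have zero_block: "Poly_Mapping.lookup m (a', b', d) = 0" for d
            by (intro zero) auto
          then have "block_deg a' b' m = 0"
            by (intro block_deg_eq_0) (simp add: in_keys_iff)
          then show ?thesis
            using lookup_le_block_deg[of m' a' b' c'] by (simp add: block zero_block w')
        qed
      qed
      moreover have "Poly_Mapping.lookup m' (a, b, c) < Poly_Mapping.lookup m (a, b, c)"
        using 1 step(2) by simp
      ultimately show ?thesis unfolding grevlex_greater_def using total by blast
    next
      case 2
      \<comment> \<open>Here \<open>(a, b, c)\<close> uses up the shift degree of \<open>m'\<close>,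
        so every other variable with positive shift is absent.\<close>
      have "Poly_Mapping.lookup m' (a', b', c') = Poly_Mapping.lookup m (a', b', c')" if "2 \<le> c'" for a' b' c'
      proof (cases "(a', b', c') = (a, b, c)")
        case False
        then show ?thesis using le[OF False] zero[OF False] that by (simp add: 2)
      qed (simp add: 2 step(2))
      then have "m' = m" using keys block by (intro monom_eqI) auto
      with m'(2) show ?thesis by simp
    qed
  qed
qed

section \<open>The ideal and its initial ideal\<close>

lemma finite_Lam: "finite (Lam l k r)"
  by (metis set_Lam_list List.finite_set)

text \<open>The variables surviving modulo \<open>G'_set l k r j\<close>: blocks of the first
  \<open>j\<close> sizes, each cut down to its first \<open>r j\<close> rows.\<close>

definition kept :: "nat \<Rightarrow> (nat \<Rightarrow> nat) \<Rightarrow> (nat \<Rightarrow> nat) \<Rightarrow> nat \<Rightarrow> idx set" where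
  "kept l k r j = Lam l k r - (Lam_j1 l k r j \<union> Lam_j2 l k r j)"

lemma kept_iff:
  "(a, b, c) \<in> kept l k r j \<longleftrightarrow> (a, b, c) \<in> Lam l k r \<and> a \<le> j \<and> c \<le> r j"
  by (auto simp: kept_def Lam_j1_def Lam_j2_def Lam_def)

lemma fibre_add_cong:
  assumes "Poly_Mapping.keys s \<subseteq> K" "Poly_Mapping.keys t \<subseteq> K"
    and "total_degree s = total_degree t" "\<And>a b. block_deg a b s = block_deg a b t"
    and "shift_deg s = shift_deg t"
  shows "n + s \<in> fibre K m \<longleftrightarrow> n + t \<in> fibre K m"
  using assms by (auto simp: fibre_def keys_add_monom deg_add)

locale jordan_sizes =
  fixes l :: nat and k r :: "nat \<Rightarrow> nat"
  assumes size_pos: "\<And>i. i \<in> {1..l} \<Longrightarrow> r i \<ge> 1"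
    and size_decreasing: "\<And>i j. i \<in> {1..l} \<Longrightarrow> j \<in> {1..l} \<Longrightarrow> i < j \<Longrightarrow> r i > r j"
begin

section \<open>Minors and fibres\<close>

lemma size_mono: "1 \<le> a \<Longrightarrow> a \<le> b \<Longrightarrow> b \<le> l \<Longrightarrow> r b \<le> r a"
  using size_decreasing[of a b] by (cases "a = b") auto

abbreviation next_minor :: "idx \<Rightarrow> idx \<Rightarrow> (idx, 'a::comm_ring_1) mpoly" where
  "next_minor i j \<equiv> next_var r i * var j - var i * next_var r j"

text \<open>The truncation \<open>s\<^bsup>r j\<^esup> = 0\<close> disposes of the rows at the end of a block.\<close>

lemma next_minor_fibre:
  assumes j: "j \<in> {1..l}" and s: "shift_deg m < r j"
    and i: "(i1, i2, i3) \<in> Lam l k r" and i': "(j1, j2, j3) \<in> Lam l k r"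
    and mem: "n + (Poly_Mapping.single (i1, i2, Suc i3) 1 + Poly_Mapping.single (j1, j2, j3) 1)
      \<in> fibre (kept l k r j) m"
  shows "j3 < r j1 \<and> n + (Poly_Mapping.single (i1, i2, i3) 1 + Poly_Mapping.single (j1, j2, Suc j3) 1)
      \<in> fibre (kept l k r j) m"
proof -
  let ?K = "kept l k r j"
  have K: "(i1, i2, Suc i3) \<in> ?K" "(j1, j2, j3) \<in> ?K"
    using mem by (auto simp: fibre_def keys_add_monom)
  \<comment> \<open>As \<open>i3\<close> is at least 1, this sum being below \<open>r j\<close>
    gives \<open>j3 < r j\<close>, so row \<open>j3\<close> has a successor even in the truncated
    block.\<close>
  have "shift_deg m = shift_deg n + i3 + (j3 - 1)"
    using mem by (auto simp: fibre_def deg_add deg_single)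
  then have lt: "j3 < r j" using s i i' by (auto simp: Lam_def)
  moreover have "r j \<le> r j1" using K(2) j by (intro size_mono) (auto simp: kept_iff Lam_def)
  ultimately have K': "(j1, j2, Suc j3) \<in> ?K" "(i1, i2, i3) \<in> ?K" and lt': "j3 < r j1"
    using K i i' by (auto simp: kept_iff Lam_def)
  have pos: "1 \<le> i3" "1 \<le> j3" using i i' by (auto simp: Lam_def)
  \<comment> \<open>Both products take one variable from each of the same two blocks and carry the
    same total shift.\<close>
  have "n + (Poly_Mapping.single (i1, i2, i3) 1 + Poly_Mapping.single (j1, j2, Suc j3) 1) \<in> fibre ?K m
    \<longleftrightarrow> n + (Poly_Mapping.single (i1, i2, Suc i3) 1 + Poly_Mapping.single (j1, j2, j3) 1) \<in> fibre ?K m"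
    using pos by (intro fibre_add_cong) (auto simp: keys_add_monom K K' deg_add deg_single)
  then show ?thesis using mem lt' by blast
qed

text \<open>The two directions come from \<open>next_minor_fibre\<close> for the pair and for the
  swapped pair. The bounds on \<open>i3\<close> and \<open>j3\<close> record when
  \<open>next_var\<close> is nonzero, so the two terms of a multiplied minor always cancel in the
  coefficient sum.\<close>

lemma next_minor_fibre_iff:
  assumes j: "j \<in> {1..l}" and s: "shift_deg m < r j"
    and i: "(i1, i2, i3) \<in> Lam l k r" and i': "(j1, j2, j3) \<in> Lam l k r"
  shows "i3 < r i1 \<and> n + (Poly_Mapping.single (i1, i2, Suc i3) 1 + Poly_Mapping.single (j1, j2, j3) 1)
      \<in> fibre (kept l k r j) m \<longleftrightarrow>
    j3 < r j1 \<and> n + (Poly_Mapping.single (i1, i2, i3) 1 + Poly_Mapping.single (j1, j2, Suc j3) 1)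
      \<in> fibre (kept l k r j) m"
  using next_minor_fibre[OF j s i i', of n] next_minor_fibre[OF j s i' i, of n]
  by (simp only: add.commute) blast

lemma coeff_sum_next_minor:
  fixes c :: "'a::comm_ring_1"
  assumes "j \<in> {1..l}" "shift_deg m < r j" "u \<in> Lam l k r" "v \<in> Lam l k r"
  shows "coeff_sum (fibre (kept l k r j) m) (Poly_Mapping.single n c * next_minor u v) = 0"
proof -
  let ?F = "fibre (kept l k r j) m"
  obtain i1 i2 i3 j1 j2 j3 where uv: "u = (i1, i2, i3)" "v = (j1, j2, j3)"
    by (cases u, cases v) auto
  have prod: "Poly_Mapping.single n c * (var x * var y) =
      Poly_Mapping.single (n + (Poly_Mapping.single x 1 + Poly_Mapping.single y 1)) c" for x y :: idx
    unfolding var_mult monom_poly_def by (simp add: mult_single)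
  have "coeff_sum ?F (Poly_Mapping.single n c * (next_var r u * var v)) =
      (if i3 < r i1 \<and> n + (Poly_Mapping.single (i1, i2, Suc i3) 1 + Poly_Mapping.single (j1, j2, j3) 1) \<in> ?F
       then c else 0)"
    unfolding uv next_var_def by (auto simp: prod coeff_sum_single)
  moreover have "coeff_sum ?F (Poly_Mapping.single n c * (var u * next_var r v)) =
      (if j3 < r j1 \<and> n + (Poly_Mapping.single (i1, i2, i3) 1 + Poly_Mapping.single (j1, j2, Suc j3) 1) \<in> ?F
       then c else 0)"
    unfolding uv next_var_def by (auto simp: prod coeff_sum_single)
  ultimately show ?thesis
    unfolding right_diff_distrib coeff_sum_diff
    using next_minor_fibre_iff[OF assms(1,2) assms(3)[unfolded uv] assms(4)[unfolded uv], of n] by simp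
qed

section \<open>The ideals and their generators\<close>

lemma next_var_in_poly_ring:
  "i \<in> Lam l k r \<Longrightarrow> next_var r i \<in> carrier (poly_ring (Lam l k r))"
  by (cases i) (auto simp: next_var_def Lam_def poly_ring_simps(1)[of 0])


lemma minors_subset: "minors 2 (Jx_x_mat l k r c) \<subseteq> carrier (poly_ring (Lam l k r))"
proof -
  interpret cring "poly_ring (Lam l k r) :: (idx, 'a::comm_ring_1) mpoly ring" by (rule poly_ring_cring)
  have closed: "x * y \<in> carrier (poly_ring (Lam l k r))"
    if "x \<in> carrier (poly_ring (Lam l k r))" "y \<in> carrier (poly_ring (Lam l k r))"
    for x y :: "(idx, 'a) mpoly"
    using m_closed[OF that] by (simp add: poly_ring_simps)
  note diff = poly_ideal_diff[OF oneideal]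
  show ?thesis
    unfolding minors_Jx_x
    by (auto intro!: diff closed next_var_in_poly_ring)
qed

lemma ideal_I: "ideal (I_ideal l k r c) (poly_ring (Lam l k r))"
  unfolding I_ideal_def by (rule poly_ideal_generated[OF minors_subset])

lemma G'_subset: "G'_set l k r j \<subseteq> carrier (poly_ring (Lam l k r))"
  by (auto simp: G'_set_def Lam_j1_def Lam_j2_def)

lemma ideal_q: "ideal (q_ideal l k r c j) (poly_ring (Lam l k r))"
  unfolding q_ideal_def
  by (rule ring.add_ideals[OF poly_ring_ring ideal_I poly_ideal_generated[OF G'_subset]])

lemma I_subset_q: "I_ideal l k r c \<subseteq> q_ideal l k r c j"
proof
  fix p assume "p \<in> I_ideal l k r c"
  then have "p + 0 \<in> q_ideal l k r c j"
    using poly_ideal_zero[OF poly_ideal_generated[OF G'_subset[of j]]]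
    unfolding q_ideal_def set_add_def' by (force simp only: poly_ring_simps)
  then show "p \<in> q_ideal l k r c j" by simp
qed

lemma G'_subset_q: "G'_set l k r j \<subseteq> q_ideal l k r c j"
proof
  fix p :: "(idx, 'a::comm_ring_1) mpoly" assume "p \<in> G'_set l k r j"
  then have "p \<in> Idl\<^bsub>poly_ring (Lam l k r)\<^esub> (G'_set l k r j)"
    using ring.genideal_self[OF poly_ring_ring G'_subset] by blast
  then have "0 + p \<in> q_ideal l k r c j"
    using poly_ideal_zero[OF ideal_I[of c]]
    unfolding q_ideal_def set_add_def' by (force simp only: poly_ring_simps)
  then show "p \<in> q_ideal l k r c j" by simp
qed

text \<open>A minor changes sign when its rows are exchanged and vanishes for equal rows. This frees
  the telescoping below from the order condition.\<close>

lemma next_minor_in_I: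
  assumes "i \<in> Lam l k r" "j \<in> Lam l k r"
  shows "next_minor i j \<in> I_ideal l k r c"
proof -
  have *: "next_minor i j \<in> I_ideal l k r c"
    if "i \<in> Lam l k r" "j \<in> Lam l k r" "idx_greater i j" for i j
    using that ring.genideal_self[OF poly_ring_ring minors_subset, of c]
    unfolding I_ideal_def minors_Jx_x by blast
  consider "idx_greater i j" | "i = j" | "idx_greater j i" using idx_greater_total by blast
  then show ?thesis
  proof cases
    case 1
    then show ?thesis using * assms by blast
  next
    case 2
    then show ?thesis using poly_ideal_zero[OF ideal_I] by (simp add: mult.commute)
  next
    case 3
    then have "- next_minor j i \<in> I_ideal l k r c"
      using * assms poly_ideal_uminus[OF ideal_I] by blast
    then show ?thesis by (simp add: mult.commute)
  qed
qed

text \<open>Coefficient form of the vanishing of \<open>q\<close> under the monomial map;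
  \<open>shift_deg m < r j\<close> says that the image of \<open>m\<close> survives truncation. It
  suffices to place both generating sets in the annihilator ideal.\<close>

lemma coeff_sum_q_ideal:
  assumes j: "j \<in> {1..l}" and s: "shift_deg m < r j" and p: "p \<in> q_ideal l k r c j"
  shows "coeff_sum (fibre (kept l k r j) m) p = 0"
proof -
  let ?F = "fibre (kept l k r j) m" and ?R = "poly_ring (Lam l k r) :: (idx, 'a::comm_ring_1) mpoly ring"
  define Z where "Z = {p \<in> carrier ?R. \<forall>h. coeff_sum ?F (h * p) = 0}"
  have Z: "ideal Z ?R" unfolding Z_def by (rule ideal_coeff_sum_annihilator)
  note minimal = ring.genideal_minimal[OF poly_ring_ring Z]
  have "minors 2 (Jx_x_mat l k r c) \<subseteq> Z"
  proof
    fix x assume x: "x \<in> minors 2 (Jx_x_mat l k r c)"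
    then obtain u v where uv: "x = next_minor u v" "u \<in> Lam l k r" "v \<in> Lam l k r"
      unfolding minors_Jx_x by blast
    have "coeff_sum ?F (h * x) = 0" for h
      unfolding uv(1) by (rule coeff_sum_mult_eq_0[OF coeff_sum_next_minor[OF j s uv(2,3)]])
    moreover have "x \<in> carrier ?R" by (rule subsetD[OF minors_subset x])
    ultimately show "x \<in> Z" by (simp add: Z_def)
  qed
  then have I: "I_ideal l k r c \<subseteq> Z" unfolding I_ideal_def by (rule minimal)
  have "G'_set l k r j \<subseteq> Z"
  proof
    fix x :: "(idx, 'a) mpoly" assume x: "x \<in> G'_set l k r j"
    then obtain v where v: "x = var v" "v \<notin> kept l k r j"
      unfolding G'_set_def kept_def by blast
    \<comment> \<open>A multiple of a discarded variable lies in no fibre over the kept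
      variables.\<close>
    have "coeff_sum ?F (Poly_Mapping.single n d * x) = 0" for n d
      unfolding v var_def monom_poly_def using v(2)
      by (auto simp: mult_single coeff_sum_single fibre_def keys_add_monom)
    then have "coeff_sum ?F (h * x) = 0" for h by (rule coeff_sum_mult_eq_0)
    moreover have "x \<in> carrier ?R" by (rule subsetD[OF G'_subset x])
    ultimately show "x \<in> Z" by (simp add: Z_def)
  qed
  then have G': "Idl\<^bsub>?R\<^esub> (G'_set l k r j) \<subseteq> Z" by (rule minimal)
  obtain a b where ab: "a \<in> I_ideal l k r c" "b \<in> Idl\<^bsub>?R\<^esub> (G'_set l k r j)" "p = a + b"
    using p unfolding q_ideal_def set_add_def' by (auto simp: poly_ring_simps(3))
  have "p \<in> Z"
    unfolding ab(3) by (rule poly_ideal_add[OF Z subsetD[OF I ab(1)] subsetD[OF G' ab(2)]])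
  \<comment> \<open>Membership in \<open>Z\<close> speaks about all multiples; the multiplier 1
    gives \<open>p\<close> itself.\<close>
  then have "coeff_sum ?F (1 * p) = 0" unfolding Z_def by (blast dest: spec)
  then show ?thesis by simp
qed

section \<open>Telescoping minors: \<open>G\<close> lies in the ideal of minors\<close>

lemma next_step_in_I:
  assumes "(a, b, c) \<in> Lam l k r" "(a', b', c') \<in> Lam l k r" "c < r a"
  shows "c' < r a' \<Longrightarrow>
      var (a, b, Suc c) * var (a', b', c') - var (a, b, c) * var (a', b', Suc c') \<in> I_ideal l k r lam"
    and "c' = r a' \<Longrightarrow> var (a, b, Suc c) * var (a', b', c') \<in> I_ideal l k r lam"
  using next_minor_in_I[OF assms(1,2), of lam] assms(3) by (simp_all add: next_var_def)

text \<open>Each minor moves one unit from the first third index to the second, keeping their sum.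
  The second reaches the end of its block before the first falls to 1, and there the minor is a
  single product. The base case contradicts \<open>c' <= r a'\<close>.\<close>

lemma vanishing_product_in_I:
  assumes "(a, b, Suc c) \<in> Lam l k r" "(a', b', c') \<in> Lam l k r" "r a' + 1 \<le> c + c'"
  shows "var (a, b, Suc c) * var (a', b', c') \<in> I_ideal l k r lam"
  using assms
proof (induction c arbitrary: c')
  case 0
  then show ?case by (simp add: Lam_def)
next
  case (Suc c)
  then have mem: "(a, b, Suc c) \<in> Lam l k r" "Suc c < r a" "c' \<le> r a'" by (auto simp: Lam_def)
  show ?case
  proof (cases "c' = r a'")
    case True
    then show ?thesis using next_step_in_I(2)[OF mem(1) Suc.prems(2) mem(2)] by blast
  next
    case False
    then have "c' < r a'" using mem(3) by simp
    then have "var (a, b, Suc c) * var (a', b', Suc c') \<in> I_ideal l k r lam"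
      using Suc.prems mem by (intro Suc.IH) (auto simp: Lam_def)
    then show ?thesis
      using poly_ideal_add[OF ideal_I next_step_in_I(1)[OF mem(1) Suc.prems(2) mem(2) \<open>c' < r a'\<close>]]
      by fastforce
  qed
qed

text \<open>A telescoping sum of the same minors, this time until the first third index has come
  down to 1.\<close>

lemma binomial_in_I:
  assumes "(a, b, Suc c) \<in> Lam l k r" "(a', b', c') \<in> Lam l k r" "c + c' \<le> r a'"
  shows "var (a, b, Suc c) * var (a', b', c') - var (a, b, 1) * var (a', b', c + c') \<in> I_ideal l k r lam"
  using assms
proof (induction c arbitrary: c')
  case 0
  then show ?case using poly_ideal_zero[OF ideal_I] by simp
next
  case (Suc c)
  then have mem: "(a, b, Suc c) \<in> Lam l k r" "Suc c < r a" "c' < r a'" by (auto simp: Lam_def)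
  have "var (a, b, Suc c) * var (a', b', Suc c') - var (a, b, 1) * var (a', b', c + Suc c')
      \<in> I_ideal l k r lam"
    using Suc.prems mem by (intro Suc.IH) (auto simp: Lam_def)
  from poly_ideal_add[OF ideal_I next_step_in_I(1)[OF mem(1) Suc.prems(2) mem(2,3)] this]
  show ?case by simp
qed

lemma G_subset_I: "G_set l k r \<subseteq> I_ideal l k r lam"
proof
  fix x :: "(idx, 'a::comm_ring_1) mpoly" assume x: "x \<in> G_set l k r"
  consider "x = 0"
    | i1 i2 i3 j1 j2 j3 where "x = var (i1, i2, Suc i3) * var (j1, j2, j3)"
        "((i1, i2, i3), (j1, j2, j3)) \<in> Gam1 l k r \<union> Gam3 l k r"
    | i1 i2 i3 j1 j2 j3 where
        "x = var (i1, i2, Suc i3) * var (j1, j2, j3) - var (i1, i2, 1) * var (j1, j2, i3 + j3)"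
        "((i1, i2, i3), (j1, j2, j3)) \<in> Gam2 l k r"
    using x by (fastforce simp: G_set_def split: if_splits)
  then show "x \<in> I_ideal l k r lam"
  proof cases
    case 1
    then show ?thesis using poly_ideal_zero[OF ideal_I] by simp
  next
    case 2
    \<comment> \<open>For \<open>Gam3\<close> the sum condition follows from
      \<open>j3 = r j1\<close> and \<open>i3 >= 1\<close>.\<close>
    then show ?thesis
      by (auto simp: Gam1_def Gam3_def Lam_def intro!: vanishing_product_in_I)
  next
    case 3
    then show ?thesis
      by (auto simp: Gam2_def Lam_def simp flip: One_nat_def intro!: binomial_in_I)
  qed
qed

lemma finite_G: "finite (G_set l k r)"
proof -
  have "finite {f i j | i j. (i, j) \<in> A}" if "A \<subseteq> Lam l k r \<times> Lam l k r"
    for A and f :: "idx \<Rightarrow> idx \<Rightarrow> (idx, 'a::comm_ring_1) mpoly"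
  proof -
    have "{f i j | i j. (i, j) \<in> A} \<subseteq> case_prod f ` A"
      by (auto intro: rev_image_eqI)
    moreover have "finite A"
      by (rule finite_subset[OF that finite_cartesian_product[OF finite_Lam finite_Lam]])
    ultimately show ?thesis by (rule finite_subset[OF _ finite_imageI])
  qed
  note finite_image = this
  have "Gam1 l k r \<union> Gam3 l k r \<subseteq> Lam l k r \<times> Lam l k r" "Gam2 l k r \<subseteq> Lam l k r \<times> Lam l k r"
    by (auto simp: Gam1_def Gam2_def Gam3_def)
  note pairs = this
  show ?thesis
    unfolding G_set_def
    using finite_image[OF pairs(1), of "\<lambda>i j. var (idx_succ i) * var j"]
      finite_image[OF pairs(2), of g_poly]
    by (simp only: finite_Un finite.intros split: if_split) simp
qed

lemma finite_G': "finite (G'_set l k r j)"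
  unfolding G'_set_def
  by (intro finite_imageI finite_subset[OF _ finite_Lam]) (auto simp: Lam_j1_def Lam_j2_def)

section \<open>Leading monomials of the generators and of \<open>q\<close>\<close>

lemma leading_monom_var: "leading_monom (grevlex_greater idx_greater) (var v :: (idx, 'a::zero_neq_one) mpoly)
    = Poly_Mapping.single v 1"
  by (rule leading_monom_eqI) (auto simp: var_def)

text \<open>The three sets \<open>Gam1\<close>, \<open>Gam2\<close>, \<open>Gam3\<close> cover all
  admissible pairs. For a pair in \<open>Gam2\<close> the subtracted monomial contains the smallest
  variable involved, so it loses in the reverse lexicographic comparison.\<close>

lemma leading_monom_in_G:
  assumes i: "(a, b, Suc c) \<in> Lam l k r" "1 \<le> c" and j: "v \<in> Lam l k r" and gt: "idx_greater (a, b, c) v"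
  obtains g :: "(idx, 'a::comm_ring_1) mpoly" where "g \<in> G_set l k r" "g \<noteq> 0"
    "leading_monom (grevlex_greater idx_greater) g =
      Poly_Mapping.single (a, b, Suc c) 1 + Poly_Mapping.single v 1"
proof -
  obtain a' b' c' where v: "v = (a', b', c')" by (cases v) auto
  let ?m = "Poly_Mapping.single (a, b, Suc c) 1 + Poly_Mapping.single v 1 :: idx monom"
  have mem: "(a, b, c) \<in> Lam l k r" "c < r a" using i by (auto simp: Lam_def)
  have "1 \<le> a" "a \<le> l" using i by (auto simp: Lam_def)
  \<comment> \<open>A block with more than one row exists, which selects the nontrivial branch of
    \<open>G_set\<close>.\<close>
  then have "1 < r 1" using size_mono[of 1 a] mem i(2) by simp
  then have G: "G_set l k r = {var (idx_succ i) * var j | i j. (i, j) \<in> Gam1 l k r \<union> Gam3 l k r} \<union>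
      {g_poly i j | i j. (i, j) \<in> Gam2 l k r}" by (simp add: G_set_def)
  have "c' \<le> r a'" "1 \<le> c'" using j v by (auto simp: Lam_def)
  then consider "((a, b, c), v) \<in> Gam1 l k r \<union> Gam3 l k r" | "((a, b, c), v) \<in> Gam2 l k r" "c + c' \<le> r a'"
    using mem j gt unfolding v Gam1_def Gam2_def Gam3_def by fastforce
  then show thesis
  proof cases
    case 1
    let ?g = "var (idx_succ (a, b, c)) * var v :: (idx, 'a) mpoly"
    have g: "?g = monom_poly ?m" by (simp add: var_mult)
    have "?g \<in> G_set l k r" unfolding G using 1 by blast
    moreover have "?g \<noteq> 0" unfolding g by (metis keys_monom_poly insert_not_empty keys_zero)
    moreover have "leading_monom (grevlex_greater idx_greater) ?g = ?m"
      unfolding g by (rule leading_monom_eqI) auto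
    ultimately show thesis using that by blast
  next
    case 2
    let ?n = "Poly_Mapping.single (a, b, 1) 1 + Poly_Mapping.single (a', b', c + c') 1 :: idx monom"
    let ?g = "g_poly (a, b, c) v :: (idx, 'a) mpoly"
    have g: "?g = Poly_Mapping.single ?m 1 - Poly_Mapping.single ?n 1"
      by (simp add: v var_mult monom_poly_def)
    have mn: "grevlex_greater idx_greater ?m ?n"
    proof -
      \<comment> \<open>Since \<open>c >= 1\<close>, this variable lies after both factors of
        \<open>?m\<close>.\<close>
      let ?v = "(a', b', c + c')"
      have "Poly_Mapping.lookup ?m ?v < Poly_Mapping.lookup ?n ?v"
        using gt i(2) by (auto simp: v lookup_add lookup_single when_def)
      moreover have "Poly_Mapping.lookup ?m w = Poly_Mapping.lookup ?n w" if "idx_greater ?v w" for w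
        using that gt i(2) by (cases w) (auto simp: v lookup_add lookup_single when_def)
      moreover have "total_degree ?m = total_degree ?n" by (simp add: deg_add deg_single)
      ultimately show ?thesis unfolding grevlex_greater_def by blast
    qed
    then have ne: "?m \<noteq> ?n" using grevlex_irrefl by metis
    have keys: "Poly_Mapping.keys ?g \<subseteq> {?m, ?n}" "?m \<in> Poly_Mapping.keys ?g"
      unfolding g using ne by (auto simp: in_keys_iff lookup_minus lookup_single when_def split: if_splits)
    have "?g \<in> G_set l k r" unfolding G using 2 by blast
    moreover have "?g \<noteq> 0" using keys(2) by (metis empty_iff keys_zero)
    moreover have "leading_monom (grevlex_greater idx_greater) ?g = ?m"
      using keys mn by (intro leading_monom_eqI) auto
    ultimately show thesis using that by blast
  qed
qed

text \<open>Divisibility is expressed by the cofactor \<open>n\<close>. A leading monomial is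
  greatest in \<open>p\<close>; were it standard in kept variables, it would also be smallest in its
  fibre.\<close>

lemma leading_monom_divisible:
  fixes p :: "(idx, 'a::comm_ring_1) mpoly"
  assumes j: "j \<in> {1..l}" and p: "p \<in> q_ideal l k r c j" "p \<noteq> 0"
  obtains g :: "(idx, 'a) mpoly" and n where "g \<in> G_set l k r \<union> G'_set l k r j" "g \<noteq> 0"
    "leading_monom (grevlex_greater idx_greater) p =
      n + leading_monom (grevlex_greater idx_greater) g"
proof -
  let ?lm = "leading_monom (grevlex_greater idx_greater)"
  let ?m = "?lm p" and ?K = "kept l k r j"
  note lm = leading_monom_greatest[OF p(2)]
  have keys: "Poly_Mapping.keys ?m \<subseteq> Lam l k r"
    using poly_ideal_subset[OF ideal_q p(1)] lm(1) by (simp add: poly_ring_simps)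
  have "\<not> (Poly_Mapping.keys ?m \<subseteq> ?K \<and> standard ?m)"
  proof
    assume std: "Poly_Mapping.keys ?m \<subseteq> ?K \<and> standard ?m"
    have pos: "1 \<le> c" if "(a, b, c) \<in> ?K" for a b c
      using that by (auto simp: kept_iff Lam_def)
    \<comment> \<open>The shift degree is 0 or \<open>c - 1\<close> for a kept variable, where
      \<open>c <= r j\<close>; so the image of \<open>?m\<close> is not truncated away.\<close>
    have "shift_deg ?m < r j"
    proof (rule standard_cases[of ?m])
      show "standard ?m" using std by blast
      show "1 \<le> c" if "(a, b, c) \<in> Poly_Mapping.keys ?m" for a b c
        using that std pos by blast
    next
      assume "shift_deg ?m = 0"
      then show "shift_deg ?m < r j" using size_pos[OF j] by simp
    next
      fix a b c
      assume step: "2 \<le> c" "Poly_Mapping.lookup ?m (a, b, c) = 1" "shift_deg ?m = c - 1"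
      then have "(a, b, c) \<in> ?K" using std by (auto simp: in_keys_iff)
      then have "c \<le> r j" by (simp add: kept_iff)
      then show "shift_deg ?m < r j" using step(1,3) by linarith
    qed
    then have "coeff_sum (fibre ?K ?m) p = 0" using j p(1) by (intro coeff_sum_q_ideal)
    moreover have "m = ?m" if "m \<in> Poly_Mapping.keys p" "m \<in> fibre ?K ?m" for m
    proof (rule ccontr)
      assume ne: "m \<noteq> ?m"
      have "grevlex_greater idx_greater m ?m"
        using std pos that(2) ne by (intro standard_minimal[of ?m ?K]) auto
      with lm(2)[OF that(1) ne] show False
        using idx_grevlex_trans[of m ?m m] grevlex_irrefl[of idx_greater m] by blast
    qed
    then have "coeff_sum (fibre ?K ?m) p = (\<Sum>m\<in>{?m}. Poly_Mapping.lookup p m)"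
      unfolding coeff_sum_def using lm(1) std
      by (intro sum.mono_neutral_cong_right) (auto simp: fibre_def)
    ultimately show False using lm(1) by (simp add: in_keys_iff)
  qed
  \<comment> \<open>The first failure is answered by a variable of \<open>G'_set\<close>, the second
    by an element of \<open>G_set\<close>.\<close>
  then consider v where "v \<in> Poly_Mapping.keys ?m" "v \<notin> ?K" | "\<not> standard ?m" by blast
  then show thesis
  proof cases
    case 1
    then have "var v \<in> G'_set l k r j" using keys by (auto simp: G'_set_def kept_def)
    moreover have "var v \<noteq> (0 :: (idx, 'a) mpoly)"
      by (metis var_def keys_monom_poly insert_not_empty keys_zero)
    moreover have "?m = (?m - Poly_Mapping.single v 1) + Poly_Mapping.single v 1"
      using 1 by (intro poly_mapping_eqI) (auto simp: lookup_add lookup_minus lookup_single when_def in_keys_iff)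
    ultimately show thesis using that[of "var v"] by (metis UnI2 leading_monom_var)
  next
    case 2
    then obtain a b c v where v: "(a, b, Suc c) \<in> Poly_Mapping.keys ?m" "1 \<le> c" "v \<in> Poly_Mapping.keys ?m"
      "idx_greater (a, b, c) v" "\<not> (v = (a, b, Suc c) \<and> Poly_Mapping.lookup ?m v = 1)"
      unfolding standard_def by blast
    let ?n = "Poly_Mapping.single (a, b, Suc c) 1 + Poly_Mapping.single v 1 :: idx monom"
    obtain g :: "(idx, 'a) mpoly" where g: "g \<in> G_set l k r" "g \<noteq> 0" "?lm g = ?n"
      using leading_monom_in_G[of a b c v] v keys by blast
    \<comment> \<open>If \<open>v = (a, b, Suc c)\<close>, its exponent differs from 1 and is
      positive, so the square divides. The bound makes the subtraction of exponents exact.\<close>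
    have "Poly_Mapping.lookup ?n w \<le> Poly_Mapping.lookup ?m w" for w
      using v by (auto simp: lookup_add lookup_single when_def in_keys_iff)
    then have "?m = (?m - ?n) + ?n"
      by (intro poly_mapping_eqI) (simp add: lookup_add lookup_minus)
    then show thesis using that[of g] g by (metis UnI1)
  qed
qed

end

theorem proposition3p14:
  fixes lam :: "'a::field" and l :: nat and k r :: "nat \<Rightarrow> nat"
  assumes "l \<ge> 1"
    and "\<And>i. i \<in> {1..l} \<Longrightarrow> k i \<ge> 1"
    and "\<And>i. i \<in> {1..l} \<Longrightarrow> r i \<ge> 1"
    and "\<And>i j. i \<in> {1..l} \<Longrightarrow> j \<in> {1..l} \<Longrightarrow> i < j \<Longrightarrow> r i > r j"
  shows "\<forall>j \<in> {1..l}.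
           groebner_basis (Lam l k r) (grevlex_greater idx_greater)
             (G_set l k r \<union> G'_set l k r j) (q_ideal l k r lam j)"
proof
  fix j assume j: "j \<in> {1..l}"
  interpret jordan_sizes l k r using assms by unfold_locales auto
  let ?G = "G_set l k r \<union> G'_set l k r j :: (idx, 'a) mpoly set"
  let ?q = "q_ideal l k r lam j" and ?R = "poly_ring (Lam l k r) :: (idx, 'a) mpoly ring"
  let ?lm = "leading_monom (grevlex_greater idx_greater) :: (idx, 'a) mpoly \<Rightarrow> idx monom"
  let ?in = "\<lambda>F. {monom_poly (?lm f) | f. f \<in> F \<and> f \<noteq> 0} :: (idx, 'a) mpoly set"
  interpret cring ?R by (rule poly_ring_cring)
  have G: "?G \<subseteq> ?q" using G_subset_I I_subset_q G'_subset_q by blast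
  have in_q: "?in ?q \<subseteq> carrier ?R"
  proof
    fix x assume "x \<in> ?in ?q"
    then obtain f where f: "f \<in> ?q" "f \<noteq> 0" "x = monom_poly (?lm f)" by blast
    then show "x \<in> carrier ?R"
      using poly_ideal_subset[OF ideal_q f(1)] leading_monom_greatest(1)[OF f(2)]
      by (simp add: poly_ring_simps(1)[of f])
  qed
  have in_G: "?in ?G \<subseteq> ?in ?q" using G by blast
  then have in_G_carrier: "?in ?G \<subseteq> carrier ?R" using in_q by blast
  have "Idl\<^bsub>?R\<^esub> (?in ?G) = Idl\<^bsub>?R\<^esub> (?in ?q)"
  proof
    show "Idl\<^bsub>?R\<^esub> (?in ?G) \<subseteq> Idl\<^bsub>?R\<^esub> (?in ?q)"
      using in_G genideal_self[OF in_q] by (intro genideal_minimal genideal_ideal in_q) blast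
    \<comment> \<open>The substantial inclusion: each leading monomial of \<open>?q\<close> is a
      multiple of one from \<open>?G\<close>.\<close>
    show "Idl\<^bsub>?R\<^esub> (?in ?q) \<subseteq> Idl\<^bsub>?R\<^esub> (?in ?G)"
    proof (intro genideal_minimal genideal_ideal in_G_carrier subsetI)
      fix x assume x: "x \<in> ?in ?q"
      then obtain f where f: "f \<in> ?q" "f \<noteq> 0" "x = monom_poly (?lm f)" by blast
      obtain g n where g: "g \<in> ?G" "g \<noteq> 0" "?lm f = n + ?lm g"
        using leading_monom_divisible[OF j f(1,2)] by blast
      then have "monom_poly (?lm g) \<in> Idl\<^bsub>?R\<^esub> (?in ?G)" using genideal_self[OF in_G_carrier] by blast
      moreover have "x = monom_poly n * monom_poly (?lm g)" by (simp add: f(3) g(3) monom_poly_mult)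
      \<comment> \<open>A factor of a monomial in the variables \<open>Lam l k r\<close> involves
        only these variables.\<close>
      moreover have "monom_poly n \<in> carrier ?R"
        using subsetD[OF in_q x] by (simp add: f(3) g(3) keys_add_monom)
      ultimately show "x \<in> Idl\<^bsub>?R\<^esub> (?in ?G)"
        using poly_ideal_mult[OF genideal_ideal[OF in_G_carrier]] by simp
    qed
  qed
  then show "groebner_basis (Lam l k r) (grevlex_greater idx_greater) ?G ?q"
    unfolding groebner_basis_def initial_ideal_def
    using ideal_q finite_G finite_G' G by blast
qed

end
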